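(* Let $k\ge 0$, $\mathcal{V}=(\emptyset,\sigma_c,\sigma_r)$ and let $(\mathcal{I},d)$, $(\mathcal{J},e)$ be $\mathcal{V}$-pointed interpretations. Then $(\mathcal{I},d)\equiv_k^{\mathcal{ALC}(\mathcal{V})}(\mathcal{J},e)$ if and only if $(\mathcal{I},d)\leftrightarrow_k(\mathcal{J},e)$, i.e. there exist an object $R$ of $\mathcal{R}^D_{*k}(\mathcal{V})$ and open pathwise embeddings $R\to F_k(\mathcal{I},d)$ and $R\to F_k(\mathcal{J},e)$.
   Context: $\mathcal{V}$-pointed interpretations ($\sigma_c,\sigma_r$ finite sets of concept and role names): interpretations $\mathcal{I}$ with nonempty domain $\Delta^{\mathcal{I}}$, concept names as subsets, role names as binary relations (names outside $\mathcal{V}$ interpreted as $\emptyset$), with a point $d\in\Delta^{\mathcal{I}}$. $\mathcal{ALC}(\mathcal{V})$-concepts: $C::=A\mid\neg C\mid C\sqcap C\mid\exists r.C$ with $A\in\sigma_c$, $r\in\sigma_r$, with the usual semantics ($(\exists r.C)^{\mathcal{I}}=\{x\mid\exists y\,(x,y)\in r^{\mathcal{I}},y\in C^{\mathcal{I}}\}$); the rank is the maximal nesting depth of $\exists$. $(\mathcal{I},d)\equiv_k^{\mathcal{ALC}(\mathcal{V})}(\mathcal{J},e)$ means $d\in C^{\mathcal{I}}$ iff $e\in C^{\mathcal{J}}$ for all $\mathcal{ALC}(\mathcal{V})$-concepts $C$ of rank at most $k$. Unravelling $\mathbb{E}_k(\mathcal{I},d)$: domain = sequences $[a_0,r_1,a_1,\dots,r_j,a_j]$,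 $0\le j\le k$, $a_0=d$, $r_i\in\sigma_r$, $(a_{i-1},a_i)\in r_i^{\mathcal{I}}$; point $[d]$; $s\in A$ iff the last element of $s$ is in $A^{\mathcal{I}}$; $(s,t)\in r$ iff $t=s[r,d']$ for some $d'$. Ordered interpretations: an object of $\mathcal{R}^D_{*k}(\mathcal{V})$ is $(\mathcal{I},d,\le)$ where $(\mathcal{I},d)$ is $\mathcal{V}$-pointed and $\le$ is a partial order on $\Delta^{\mathcal{I}}$ such that $\uparrow(d)=\{x\mid d\le x\}$ is a tree order of height at most $k$ and for $x,y\in\uparrow(d)$: $x\prec y$ (covering relation: $x<y$ with nothing strictly between) iff $(x,y)\in r^{\mathcal{I}}$ for some $r\in\sigma_r$. Morphisms are point-preserving homomorphisms (preserving concept and role names) that preserve the covering relation. An embedding is a morphism that is an injective strong homomorphism (it reflects as well as preserves concept and role memberships). A path is an object whose order is linear; a path embedding is an embedding whose domain is a path. A morphism $f:X\to Y$ is a pathwise embedding if $f\circ e$ is a path embedding for every path embedding $e:P\to X$. $f:X\to Y$ is open if whenever $P,Q$ are paths with embeddings $m:P\to Q$, $u:P\to X$, $v:Q\to Y$ and $f\circ u=v\circ m$, there is an embedding $w:Q\to X$ with $w\circ m=u$ and $f\circ w=v$. $F_k(\mathcal{I},d)=(\mathbb{E}_k(\mathcal{I},d),\sqsubseteq)$ where $\sqsubseteq$ is the prefix order on sequences.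
   Formalization: Paths are required to be finite linear objects, and the case where σ_c is empty while σ_r is nonempty and k ≥ 1 is excluded (the grammar then yields no concepts); without these two changes the statement is false. *)

theory Defs
  imports Main "HOL-Library.Sublist"
begin

record ('a, 'c, 'r) interp =
  dom :: "'a set"
  conc :: "'c \<Rightarrow> 'a set"
  rol :: "'r \<Rightarrow> ('a \<times> 'a) set"

definition interpretation_over :: "'c set \<Rightarrow> 'r set \<Rightarrow> ('a, 'c, 'r, 'z) interp_scheme \<Rightarrow> bool" where
  "interpretation_over \<sigma>c \<sigma>r I \<longleftrightarrow>
     dom I \<noteq> {} \<and>
     (\<forall>A. conc I A \<subseteq> dom I) \<and> (\<forall>A. A \<notin> \<sigma>c \<longrightarrow> conc I A = {}) \<and>
     (\<forall>r. rol I r \<subseteq> dom I \<times> dom I) \<and> (\<forall>r. r \<notin> \<sigma>r \<longrightarrow> rol I r = {})"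

definition pointed_over :: "'c set \<Rightarrow> 'r set \<Rightarrow> ('a, 'c, 'r, 'z) interp_scheme \<Rightarrow> 'a \<Rightarrow> bool" where
  "pointed_over \<sigma>c \<sigma>r I d \<longleftrightarrow> interpretation_over \<sigma>c \<sigma>r I \<and> d \<in> dom I"

datatype (concept_names: 'c, role_names: 'r) alc =
    Name 'c
  | Neg "('c, 'r) alc"
  | Conj "('c, 'r) alc" "('c, 'r) alc"
  | Ex 'r "('c, 'r) alc"

definition alc_concepts :: "'c set \<Rightarrow> 'r set \<Rightarrow> ('c, 'r) alc set" where
  "alc_concepts \<sigma>c \<sigma>r = {C. concept_names C \<subseteq> \<sigma>c \<and> role_names C \<subseteq> \<sigma>r}"

primrec rank :: "('c, 'r) alc \<Rightarrow> nat" where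
  "rank (Name A) = 0"
| "rank (Neg C) = rank C"
| "rank (Conj C D) = max (rank C) (rank D)"
| "rank (Ex r C) = Suc (rank C)"

primrec extension :: "('a, 'c, 'r, 'z) interp_scheme \<Rightarrow> ('c, 'r) alc \<Rightarrow> 'a set" where
  "extension I (Name A) = conc I A"
| "extension I (Neg C) = dom I - extension I C"
| "extension I (Conj C D) = extension I C \<inter> extension I D"
| "extension I (Ex r C) = {x \<in> dom I. \<exists>y. (x, y) \<in> rol I r \<and> y \<in> extension I C}"

definition alc_equiv ::
  "'c set \<Rightarrow> 'r set \<Rightarrow> nat \<Rightarrow> ('a, 'c, 'r) interp \<Rightarrow> 'a \<Rightarrow> ('b, 'c, 'r) interp \<Rightarrow> 'b \<Rightarrow> bool" where
  "alc_equiv \<sigma>c \<sigma>r k I d J e \<longleftrightarrow>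
     (\<forall>C \<in> alc_concepts \<sigma>c \<sigma>r. rank C \<le> k \<longrightarrow> (d \<in> extension I C \<longleftrightarrow> e \<in> extension J C))"

record ('a, 'c, 'r) ointerp = "('a, 'c, 'r) interp" +
  point :: 'a
  ord :: "('a \<times> 'a) set"

definition up_set :: "('a \<times> 'a) set \<Rightarrow> 'a \<Rightarrow> 'a set" where
  "up_set le d = {x. (d, x) \<in> le}"

definition covers :: "('a \<times> 'a) set \<Rightarrow> 'a \<Rightarrow> 'a \<Rightarrow> bool" where
  "covers le x y \<longleftrightarrow>
     (x, y) \<in> le \<and> x \<noteq> y \<and> \<not> (\<exists>z. (x, z) \<in> le \<and> x \<noteq> z \<and> (z, y) \<in> le \<and> z \<noteq> y)"

definition tree_order_on :: "'a set \<Rightarrow> ('a \<times> 'a) set \<Rightarrow> bool" where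
  "tree_order_on T le \<longleftrightarrow>
     partial_order_on T le \<and>
     (\<exists>x \<in> T. \<forall>y \<in> T. (x, y) \<in> le) \<and>
     (\<forall>x \<in> T. finite {y \<in> T. (y, x) \<in> le} \<and> {y \<in> T. (y, x) \<in> le} \<in> Chains le)"

text \<open>Height counts covering steps, not elements: a chain with \<open>k + 1\<close> elements has height \<open>k\<close>,
  so that the sequences with at most \<open>k\<close> steps form a tree of height at most \<open>k\<close>.\<close>

definition height_le :: "nat \<Rightarrow> 'a set \<Rightarrow> ('a \<times> 'a) set \<Rightarrow> bool" where
  "height_le k T le \<longleftrightarrow> (\<forall>C. C \<subseteq> T \<and> C \<in> Chains le \<longrightarrow> finite C \<and> card C \<le> k + 1)"

definition is_object :: "'c set \<Rightarrow> 'r set \<Rightarrow> nat \<Rightarrow> ('a, 'c, 'r) ointerp \<Rightarrow> bool" where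
  "is_object \<sigma>c \<sigma>r k X \<longleftrightarrow>
     pointed_over \<sigma>c \<sigma>r X (point X) \<and>
     partial_order_on (dom X) (ord X) \<and>
     (let U = up_set (ord X) (point X) in
        tree_order_on U (Restr (ord X) U) \<and> height_le k U (Restr (ord X) U) \<and>
        (\<forall>x \<in> U. \<forall>y \<in> U. covers (ord X) x y \<longleftrightarrow> (\<exists>r \<in> \<sigma>r. (x, y) \<in> rol X r)))"

text \<open>Morphisms are represented by total functions; only their values on the domain matter.\<close>

definition morphism :: "('a \<Rightarrow> 'b) \<Rightarrow> ('a, 'c, 'r) ointerp \<Rightarrow> ('b, 'c, 'r) ointerp \<Rightarrow> bool" where
  "morphism f X Y \<longleftrightarrow>
     f ` dom X \<subseteq> dom Y \<and> f (point X) = point Y \<and>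
     (\<forall>A. \<forall>x \<in> dom X. x \<in> conc X A \<longrightarrow> f x \<in> conc Y A) \<and>
     (\<forall>r. \<forall>x \<in> dom X. \<forall>y \<in> dom X. (x, y) \<in> rol X r \<longrightarrow> (f x, f y) \<in> rol Y r) \<and>
     (\<forall>x \<in> dom X. \<forall>y \<in> dom X. covers (ord X) x y \<longrightarrow> covers (ord Y) (f x) (f y))"

definition embedding :: "('a \<Rightarrow> 'b) \<Rightarrow> ('a, 'c, 'r) ointerp \<Rightarrow> ('b, 'c, 'r) ointerp \<Rightarrow> bool" where
  "embedding f X Y \<longleftrightarrow>
     morphism f X Y \<and> inj_on f (dom X) \<and>
     (\<forall>A. \<forall>x \<in> dom X. f x \<in> conc Y A \<longrightarrow> x \<in> conc X A) \<and>
     (\<forall>r. \<forall>x \<in> dom X. \<forall>y \<in> dom X. (f x, f y) \<in> rol Y r \<longrightarrow> (x, y) \<in> rol X r)"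

text \<open>A path is a finite linear object. Finiteness has to be stated because the tree condition only
  constrains the elements above the point. Without it, a dense linear order that has the point as
  its greatest element would be a path without any covering pair. Such paths embed into every
  countably infinite object whatever its tree structure, and pathwise embeddings would have to be
  injective there.\<close>

definition path :: "'c set \<Rightarrow> 'r set \<Rightarrow> nat \<Rightarrow> ('a, 'c, 'r) ointerp \<Rightarrow> bool" where
  "path \<sigma>c \<sigma>r k P \<longleftrightarrow> is_object \<sigma>c \<sigma>r k P \<and> linear_order_on (dom P) (ord P) \<and> finite (dom P)"

definition path_embedding ::
  "'c set \<Rightarrow> 'r set \<Rightarrow> nat \<Rightarrow> ('a \<Rightarrow> 'b) \<Rightarrow> ('a, 'c, 'r) ointerp \<Rightarrow> ('b, 'c, 'r) ointerp \<Rightarrow> bool" where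
  "path_embedding \<sigma>c \<sigma>r k f P X \<longleftrightarrow> path \<sigma>c \<sigma>r k P \<and> embedding f P X"

text \<open>In the next two definitions the paths range over objects whose elements have the same type as
  those of the object they embed into. This is no restriction: a path that embeds into an object is
  isomorphic to one carried by its image, and all conditions are invariant under isomorphism of the
  paths involved.\<close>

definition pathwise_embedding ::
  "'c set \<Rightarrow> 'r set \<Rightarrow> nat \<Rightarrow> ('a \<Rightarrow> 'b) \<Rightarrow> ('a, 'c, 'r) ointerp \<Rightarrow> ('b, 'c, 'r) ointerp \<Rightarrow> bool" where
  "pathwise_embedding \<sigma>c \<sigma>r k f X Y \<longleftrightarrow>
     morphism f X Y \<and>
     (\<forall>(P :: ('a, 'c, 'r) ointerp) e.
        path_embedding \<sigma>c \<sigma>r k e P X \<longrightarrow> path_embedding \<sigma>c \<sigma>r k (f \<circ> e) P Y)"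

definition open_morphism ::
  "'c set \<Rightarrow> 'r set \<Rightarrow> nat \<Rightarrow> ('a \<Rightarrow> 'b) \<Rightarrow> ('a, 'c, 'r) ointerp \<Rightarrow> ('b, 'c, 'r) ointerp \<Rightarrow> bool" where
  "open_morphism \<sigma>c \<sigma>r k f X Y \<longleftrightarrow>
     morphism f X Y \<and>
     (\<forall>(P :: ('a, 'c, 'r) ointerp) (Q :: ('b, 'c, 'r) ointerp) m u v.
        path \<sigma>c \<sigma>r k P \<and> path \<sigma>c \<sigma>r k Q \<and>
        embedding m P Q \<and> embedding u P X \<and> embedding v Q Y \<and>
        (\<forall>p \<in> dom P. f (u p) = v (m p)) \<longrightarrow>
        (\<exists>w. embedding w Q X \<and>
             (\<forall>p \<in> dom P. w (m p) = u p) \<and> (\<forall>q \<in> dom Q. f (w q) = v q)))"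

text \<open>The sequence \<open>[a\<^sub>0, r\<^sub>1, a\<^sub>1, \<dots>, r\<^sub>j, a\<^sub>j]\<close> is represented by
  \<open>(a\<^sub>0, [(r\<^sub>1, a\<^sub>1), \<dots>, (r\<^sub>j, a\<^sub>j)])\<close>.\<close>

type_synonym ('a, 'r) walk = "'a \<times> ('r \<times> 'a) list"

fun walk_last :: "('a, 'r) walk \<Rightarrow> 'a" where
  "walk_last (a, ws) = (if ws = [] then a else snd (last ws))"

fun walk_snoc :: "('a, 'r) walk \<Rightarrow> 'r \<Rightarrow> 'a \<Rightarrow> ('a, 'r) walk" where
  "walk_snoc (a, ws) r b = (a, ws @ [(r, b)])"

fun steps_from :: "'r set \<Rightarrow> ('a, 'c, 'r) interp \<Rightarrow> 'a \<Rightarrow> ('r \<times> 'a) list \<Rightarrow> bool" where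
  "steps_from \<sigma>r I a [] \<longleftrightarrow> True"
| "steps_from \<sigma>r I a ((r, b) # ws) \<longleftrightarrow> r \<in> \<sigma>r \<and> (a, b) \<in> rol I r \<and> steps_from \<sigma>r I b ws"

definition walks :: "'r set \<Rightarrow> nat \<Rightarrow> ('a, 'c, 'r) interp \<Rightarrow> 'a \<Rightarrow> ('a, 'r) walk set" where
  "walks \<sigma>r k I d = {(d, ws) | ws. length ws \<le> k \<and> steps_from \<sigma>r I d ws}"

definition unravelling ::
  "'r set \<Rightarrow> nat \<Rightarrow> ('a, 'c, 'r) interp \<Rightarrow> 'a \<Rightarrow> (('a, 'r) walk, 'c, 'r) interp" where
  "unravelling \<sigma>r k I d =
     \<lparr> dom = walks \<sigma>r k I d,
       conc = (\<lambda>A. {s \<in> walks \<sigma>r k I d. walk_last s \<in> conc I A}),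
       rol = (\<lambda>r. {(s, t). s \<in> walks \<sigma>r k I d \<and> t \<in> walks \<sigma>r k I d \<and> (\<exists>b. t = walk_snoc s r b)}) \<rparr>"

definition ordered_unravelling ::
  "'r set \<Rightarrow> nat \<Rightarrow> ('a, 'c, 'r) interp \<Rightarrow> 'a \<Rightarrow> (('a, 'r) walk, 'c, 'r) ointerp" where
  "ordered_unravelling \<sigma>r k I d =
     (let E = unravelling \<sigma>r k I d in
       \<lparr> dom = dom E, conc = conc E, rol = rol E,
         point = (d, []),
         ord = {(s, t). s \<in> dom E \<and> t \<in> dom E \<and> fst s = fst t \<and> prefix (snd s) (snd t)} \<rparr>)"

text \<open>The type argument is the type of the elements of the object \<open>R\<close>, since HOL cannot quantify
  existentially over it.\<close>

definition open_span ::
  "'p itself \<Rightarrow> 'c set \<Rightarrow> 'r set \<Rightarrow> nat \<Rightarrow>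
   ('a, 'c, 'r) interp \<Rightarrow> 'a \<Rightarrow> ('b, 'c, 'r) interp \<Rightarrow> 'b \<Rightarrow> bool" where
  "open_span (_ :: 'p itself) \<sigma>c \<sigma>r k I d J e \<longleftrightarrow>
     (\<exists>(R :: ('p, 'c, 'r) ointerp) f g.
        is_object \<sigma>c \<sigma>r k R \<and>
        open_morphism \<sigma>c \<sigma>r k f R (ordered_unravelling \<sigma>r k I d) \<and>
        pathwise_embedding \<sigma>c \<sigma>r k f R (ordered_unravelling \<sigma>r k I d) \<and>
        open_morphism \<sigma>c \<sigma>r k g R (ordered_unravelling \<sigma>r k J e) \<and>
        pathwise_embedding \<sigma>c \<sigma>r k g R (ordered_unravelling \<sigma>r k J e))"

end

theory Submission
  imports Defs
begin

text \<open>From a span to concepts: let \<open>f : R \<rightarrow> F\<^sub>k(I, d)\<close> be an open pathwise embedding. The elements of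
  \<open>R\<close> between the point and some \<open>x\<close> form a path, so \<open>f\<close> preserves and reflects concept names at
  \<open>x\<close>; openness for the path of prefixes of a one-step extension of \<open>f x\<close> lifts that extension to
  a successor of \<open>x\<close>. Hence \<open>x\<close> and the last element of \<open>f x\<close> satisfy the same concepts up to the
  remaining rank, and two such morphisms out of \<open>R\<close> transfer concepts from \<open>I\<close> to \<open>J\<close>.

  From concepts to a span: take as test concepts of rank \<open>n\<close> the concept names and one \<open>\<exists>r\<close> for each
  conjunction of signed test concepts of rank \<open>n - 1\<close>. There are finitely many, and agreement on
  them is a bisimulation graded by \<open>n\<close>. The pairs of walks that follow the same roles and are
  related at every position form a tree \<open>R\<close>, and its projections lift one-step extensions. Such a
  projection is open, because a path in a tree is determined by its greatest element, and it is a
  pathwise embedding, because it preserves the level, which is injective on paths.\<close>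

section \<open>Finite orders and labelled trees\<close>

text \<open>Morphisms preserve covering pairs only, so a strict inequality has to be cut into
  covering steps before it can be transported. If \<open>x\<close>, \<open>y\<close> is not a
  covering pair, both halves at an intermediate \<open>z\<close> span strictly smaller intervals,
  and finiteness makes this stop.\<close>

lemma less_imp_trancl_covers:
  assumes po: "partial_order_on A le" and fin: "finite A"
  shows "(x, y) \<in> le \<Longrightarrow> x \<noteq> y \<Longrightarrow> (x, y) \<in> {(a, b). covers le a b}\<^sup>+"
proof (induction "card {z. (x, z) \<in> le \<and> (z, y) \<in> le}" arbitrary: x y rule: less_induct)
  case less
  have tr: "trans le" and an: "antisym le" and sub: "le \<subseteq> A \<times> A" and rf: "refl_on A le"
    using po by (auto simp: partial_order_on_def preorder_on_def)
  have fin': "finite {z. (a, z) \<in> le \<and> (z, b) \<in> le}" for a b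
    by (rule finite_subset[OF _ fin]) (use sub in auto)
  have rx: "(x, x) \<in> le" "(y, y) \<in> le"
    using less.prems sub rf by (auto simp: refl_on_def)
  show ?case
  proof (cases "covers le x y")
    case True
    then show ?thesis by auto
  next
    case False
    then obtain z where z: "(x, z) \<in> le" "x \<noteq> z" "(z, y) \<in> le" "z \<noteq> y"
      using less.prems by (auto simp: covers_def)
    have 1: "{w. (x, w) \<in> le \<and> (w, z) \<in> le} \<subset> {w. (x, w) \<in> le \<and> (w, y) \<in> le}"
      using z rx less.prems an by (auto dest: transD[OF tr] antisymD[OF an])
    have 2: "{w. (z, w) \<in> le \<and> (w, y) \<in> le} \<subset> {w. (x, w) \<in> le \<and> (w, y) \<in> le}"
      using z rx less.prems an by (auto dest: transD[OF tr] antisymD[OF an])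
    have "(x, z) \<in> {(a, b). covers le a b}\<^sup>+"
      by (rule less.hyps) (use 1 fin' z in \<open>auto intro: psubset_card_mono\<close>)
    moreover have "(z, y) \<in> {(a, b). covers le a b}\<^sup>+"
      by (rule less.hyps) (use 2 fin' z in \<open>auto intro: psubset_card_mono\<close>)
    ultimately show ?thesis by (rule trancl_trans)
  qed
qed

text \<open>An element of a labelled tree is thought of as a node reached by the roles \<open>lab x\<close>, and
  \<open>prune n x\<close> as its ancestor at depth \<open>n\<close>, or \<open>x\<close> itself if \<open>n\<close> exceeds the depth of \<open>x\<close>.\<close>

locale labelled_tree =
  fixes \<sigma>c :: "'c set" and \<sigma>r :: "'r set" and k :: nat
    and X :: "('p, 'c, 'r) ointerp"
    and lab :: "'p \<Rightarrow> 'r list" and prune :: "nat \<Rightarrow> 'p \<Rightarrow> 'p"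
  assumes point_dom: "point X \<in> dom X"
    and prune_dom: "x \<in> dom X \<Longrightarrow> prune n x \<in> dom X"
    and lab_prune: "x \<in> dom X \<Longrightarrow> lab (prune n x) = take n (lab x)"
    and prune_prune: "x \<in> dom X \<Longrightarrow> prune n (prune m x) = prune (min n m) x"
    and prune_length: "x \<in> dom X \<Longrightarrow> prune (length (lab x)) x = x"
    and prune_0: "x \<in> dom X \<Longrightarrow> prune 0 x = point X"
    and set_lab: "x \<in> dom X \<Longrightarrow> set (lab x) \<subseteq> \<sigma>r"
    and length_lab: "x \<in> dom X \<Longrightarrow> length (lab x) \<le> k"
    and conc_dom: "conc X A \<subseteq> dom X"
    and conc_outside: "A \<notin> \<sigma>c \<Longrightarrow> conc X A = {}"
    and ord_iff: "(x, y) \<in> ord X \<longleftrightarrow> x \<in> dom X \<and> y \<in> dom X \<and> x = prune (length (lab x)) y"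
    and rol_iff: "(x, y) \<in> rol X r \<longleftrightarrow> (x, y) \<in> ord X \<and> lab y = lab x @ [r]"
begin

abbreviation level :: "'p \<Rightarrow> nat" where
  "level x \<equiv> length (lab x)"

section \<open>Order and covering relation of a labelled tree\<close>

lemma ord_level_le: "(x, y) \<in> ord X \<Longrightarrow> level x \<le> level y"
  by (metis lab_prune length_take min.cobounded1 ord_iff)

lemma ord_same_level: "(x, y) \<in> ord X \<Longrightarrow> level x = level y \<Longrightarrow> x = y"
  by (metis ord_iff prune_length)

lemma ord_refl: "x \<in> dom X \<Longrightarrow> (x, x) \<in> ord X"
  by (simp add: ord_iff prune_length)

lemma ord_trans: "(x, y) \<in> ord X \<Longrightarrow> (y, z) \<in> ord X \<Longrightarrow> (x, z) \<in> ord X"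
  using ord_level_le[of x y] by (metis ord_iff prune_prune min.absorb1)

lemma ord_antisym: "(x, y) \<in> ord X \<Longrightarrow> (y, x) \<in> ord X \<Longrightarrow> x = y"
  using ord_level_le ord_same_level by (meson le_antisym)

lemma partial_order: "partial_order_on (dom X) (ord X)"
  unfolding partial_order_on_def preorder_on_def
  by (auto simp: refl_on_def trans_def antisym_def ord_refl
      intro: ord_trans ord_antisym) (auto simp: ord_iff)

text \<open>Both \<open>y\<close> and \<open>z\<close> are the ancestors of \<open>x\<close> at
  their own levels, so the shallower one is also an ancestor of the deeper one.\<close>

lemma ord_linear_below:
  assumes "(y, x) \<in> ord X" "(z, x) \<in> ord X"
  shows "(y, z) \<in> ord X \<or> (z, y) \<in> ord X"
proof -
  have *: "(y, z) \<in> ord X" if "(y, x) \<in> ord X" "(z, x) \<in> ord X" "level y \<le> level z" for y z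
    using that by (metis ord_iff prune_prune min.absorb1)
  show ?thesis
    using *[of y z] *[of z y] assms by linarith
qed

lemma prune_le: "x \<in> dom X \<Longrightarrow> (prune n x, x) \<in> ord X"
  using prune_prune[of x "level (prune n x)" "level x"] prune_prune[of x n "level x"]
    prune_length[of x]
  by (simp add: ord_iff prune_dom lab_prune min.commute)

lemma point_le: "x \<in> dom X \<Longrightarrow> (point X, x) \<in> ord X"
  by (metis prune_le prune_0)

lemma lab_point: "lab (point X) = []"
  by (metis lab_prune point_dom prune_0 take_0)

lemma ord_lab: "(x, y) \<in> ord X \<Longrightarrow> lab x = take (level x) (lab y)"
  by (metis lab_prune ord_iff)

lemma covers_iff: "covers (ord X) x y \<longleftrightarrow> (x, y) \<in> ord X \<and> level y = Suc (level x)"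
proof
  assume c: "covers (ord X) x y"
  then have xy: "(x, y) \<in> ord X" "x \<noteq> y" by (auto simp: covers_def)
  then have lt: "level x < level y"
    using ord_level_le ord_same_level le_neq_implies_less by blast
  \<comment> \<open>The ancestor of \<open>y\<close> one level deeper than \<open>x\<close>. It lies
    above \<open>x\<close> because elements below \<open>y\<close> are comparable, and covering then
    forces it to be \<open>y\<close>.\<close>
  define z where "z = prune (Suc (level x)) y"
  have y: "y \<in> dom X" using xy by (simp add: ord_iff)
  have z: "(z, y) \<in> ord X" "level z = Suc (level x)"
    unfolding z_def using y lt by (auto simp: prune_le lab_prune)
  have "(x, z) \<in> ord X"
    using ord_linear_below[OF xy(1) z(1)] z(2) ord_level_le[of z x] by auto
  moreover have "x \<noteq> z" using z(2) by auto
  ultimately have "z = y" using c z by (auto simp: covers_def)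
  then show "(x, y) \<in> ord X \<and> level y = Suc (level x)" using xy z by simp
next
  assume a: "(x, y) \<in> ord X \<and> level y = Suc (level x)"
  have False if "(x, z) \<in> ord X" "x \<noteq> z" "(z, y) \<in> ord X" "z \<noteq> y" for z
  proof -
    have "level x < level z" "level z < level y"
      using that ord_level_le ord_same_level le_neq_implies_less by blast+
    then show False using a by simp
  qed
  then show "covers (ord X) x y" using a by (auto simp: covers_def)
qed

lemma covers_iff_rol: "covers (ord X) x y \<longleftrightarrow> (\<exists>r \<in> \<sigma>r. (x, y) \<in> rol X r)"
proof
  assume "covers (ord X) x y"
  then have a: "(x, y) \<in> ord X" "level y = Suc (level x)" by (auto simp: covers_iff)
  then have "lab y \<noteq> []" by auto
  then have "lab y = lab x @ [last (lab y)]"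
    using ord_lab[OF a(1)] a(2) by (metis append_butlast_last_id butlast_conv_take diff_Suc_1)
  moreover have "last (lab y) \<in> \<sigma>r"
    using \<open>lab y \<noteq> []\<close> set_lab a(1) by (meson last_in_set ord_iff subsetD)
  ultimately show "\<exists>r \<in> \<sigma>r. (x, y) \<in> rol X r" using a by (auto simp: rol_iff)
next
  assume "\<exists>r \<in> \<sigma>r. (x, y) \<in> rol X r"
  then show "covers (ord X) x y" by (auto simp: rol_iff covers_iff)
qed

lemma up_set_point: "up_set (ord X) (point X) = dom X"
  by (auto simp: up_set_def point_le) (simp add: ord_iff)

lemma finite_below: "finite {y. (y, x) \<in> ord X}"
proof (rule finite_subset)
  show "{y. (y, x) \<in> ord X} \<subseteq> (\<lambda>n. prune n x) ` {..level x}"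
    using ord_level_le by (fastforce simp: ord_iff)
qed simp

text \<open>Comparable elements of equal level coincide, so the level is injective on a chain; its
  values lie between 0 and \<open>k\<close>, which leaves room for \<open>k + 1\<close>
  elements.\<close>

lemma height: "height_le k (dom X) (ord X)"
  unfolding height_le_def
proof (intro allI impI)
  fix C assume C: "C \<subseteq> dom X \<and> C \<in> Chains (ord X)"
  have inj: "inj_on level C"
    using C by (auto simp: inj_on_def Chains_def dest: ord_same_level) (metis ord_same_level)
  have sub: "level ` C \<subseteq> {..k}" using C length_lab by auto
  have "finite C" using finite_imageD[OF finite_subset[OF sub] inj] by simp
  moreover have "card C \<le> k + 1"
    using card_mono[OF _ sub] card_image[OF inj] by simp
  ultimately show "finite C \<and> card C \<le> k + 1" by simp
qed

lemma object: "is_object \<sigma>c \<sigma>r k X"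
proof -
  have restr: "Restr (ord X) (dom X) = ord X" by (auto simp: ord_iff)
  have "pointed_over \<sigma>c \<sigma>r X (point X)"
    unfolding pointed_over_def interpretation_over_def
    using point_dom conc_dom conc_outside set_lab
    by (auto simp: rol_iff ord_iff)
      (metis append_is_Nil_conv in_set_conv_decomp set_lab subset_iff)
  moreover have "tree_order_on (dom X) (ord X)"
    unfolding tree_order_on_def
    using partial_order point_dom point_le
    by (auto simp: Chains_def intro: finite_subset[OF _ finite_below] dest: ord_linear_below)
  ultimately show ?thesis
    by (simp add: is_object_def up_set_point restr partial_order height covers_iff_rol)
qed

section \<open>Morphisms from finite paths into a labelled tree\<close>

lemma path_morphism_mono:
  assumes P: "path \<sigma>c \<sigma>r k P" and e: "morphism e P X"
    and le: "(p, q) \<in> ord P" and ne: "p \<noteq> q"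
  shows "(e p, e q) \<in> ord X \<and> level (e p) < level (e q)"
proof -
  have po: "partial_order_on (dom P) (ord P)" and fin: "finite (dom P)"
    using P by (auto simp: path_def is_object_def)
  then have sub: "ord P \<subseteq> dom P \<times> dom P"
    by (auto simp: partial_order_on_def preorder_on_def)
  \<comment> \<open>Covering pairs go to covering pairs, that is, one level deeper; \<open>p\<close>
    and \<open>q\<close> are linked by a nonempty chain of such steps.\<close>
  have covers_step: "(e a, e b) \<in> ord X \<and> level (e a) < level (e b)" if "covers (ord P) a b" for a b
  proof -
    have "a \<in> dom P" "b \<in> dom P" using that sub by (auto simp: covers_def)
    then have "covers (ord X) (e a) (e b)" using that e by (simp add: morphism_def)
    then show ?thesis by (simp add: covers_iff)
  qed
  from less_imp_trancl_covers[OF po fin le ne] show ?thesis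
  proof (induction rule: trancl_induct)
    case (step b c)
    then show ?case using covers_step[of b c] by (auto intro: ord_trans)
  qed (use covers_step in simp)
qed

lemma path_morphism_le:
  assumes "path \<sigma>c \<sigma>r k P" "morphism e P X" "(p, q) \<in> ord P"
  shows "(e p, e q) \<in> ord X"
proof (cases "p = q")
  case True
  then have "p \<in> dom P"
    using assms by (auto simp: path_def is_object_def partial_order_on_def preorder_on_def)
  then show ?thesis using True assms(2) by (auto simp: morphism_def intro: ord_refl)
qed (use path_morphism_mono[OF assms] in simp)

lemma path_linear:
  assumes "path \<sigma>c \<sigma>r k P" "p \<in> dom P" "q \<in> dom P" "p \<noteq> q"
  shows "(p, q) \<in> ord P \<or> (q, p) \<in> ord P"
  using assms by (auto simp: path_def linear_order_on_def total_on_def)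

text \<open>Distinct elements of a path are comparable, hence strictly separated by level in the
  image. In particular every morphism from a path into a labelled tree is injective.\<close>

lemma path_morphism_inj:
  assumes "path \<sigma>c \<sigma>r k P" "morphism e P X"
  shows "inj_on (\<lambda>p. level (e p)) (dom P)"
proof (rule inj_onI, rule ccontr)
  fix p q assume "p \<in> dom P" "q \<in> dom P" "level (e p) = level (e q)" "p \<noteq> q"
  then show False
    using path_linear[OF assms(1), of p q] path_morphism_mono[OF assms, of p q]
      path_morphism_mono[OF assms, of q p] by auto
qed

text \<open>Levels increase strictly along the path, so an element strictly between \<open>p\<close>
  and \<open>q\<close> would need a level strictly between two consecutive numbers. Adjacency in the
  path can thus be read off the levels in the tree.\<close>

lemma path_morphism_covers:
  assumes P: "path \<sigma>c \<sigma>r k P" "morphism e P X"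
    and dom: "p \<in> dom P" "q \<in> dom P" and lev: "level (e q) = Suc (level (e p))"
  shows "covers (ord P) p q"
proof -
  have "p \<noteq> q" using lev by auto
  moreover have "(q, p) \<notin> ord P" using path_morphism_mono[OF P, of q p] lev \<open>p \<noteq> q\<close> by fastforce
  ultimately have "(p, q) \<in> ord P" using path_linear[OF P(1) dom] by blast
  moreover have False if "(p, z) \<in> ord P" "p \<noteq> z" "(z, q) \<in> ord P" "z \<noteq> q" for z
    using path_morphism_mono[OF P that(1,2)] path_morphism_mono[OF P that(3,4)] lev by linarith
  ultimately show ?thesis using \<open>p \<noteq> q\<close> by (auto simp: covers_def)
qed

end

text \<open>In a tree all elements of the path go to ancestors of the image of its top. Openness is
  thereby reduced to lifting a single element.\<close>

lemma path_greatest: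
  assumes P: "path \<sigma>c \<sigma>r k P"
  shows "\<exists>t \<in> dom P. \<forall>p \<in> dom P. (p, t) \<in> ord P"
proof -
  have po: "partial_order_on (dom P) (ord P)" and tot: "total_on (dom P) (ord P)"
    and fin: "finite (dom P)" and ne: "dom P \<noteq> {}"
    using P by (auto simp: path_def is_object_def linear_order_on_def pointed_over_def)
  have tr: "trans (ord P)" and rf: "refl_on (dom P) (ord P)"
    using po by (auto simp: partial_order_on_def preorder_on_def)
  have "\<exists>t \<in> S. \<forall>p \<in> S. (p, t) \<in> ord P" if "finite S" "S \<noteq> {}" "S \<subseteq> dom P" for S
    using that
  proof (induction rule: finite_ne_induct)
    case (singleton x)
    then show ?case using rf by (simp add: refl_on_def)
  next
    case (insert x S)
    then obtain t where t: "t \<in> S" "\<forall>p \<in> S. (p, t) \<in> ord P" by auto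
    have dom: "x \<in> dom P" "t \<in> dom P" "(x, x) \<in> ord P"
      using insert.prems t(1) rf by (auto simp: refl_on_def)
    show ?case
    proof (cases "(x, t) \<in> ord P")
      case False
      then have "(t, x) \<in> ord P" using tot dom by (metis total_on_def)
      then show ?thesis using t dom by (auto intro: transD[OF tr])
    qed (use t in auto)
  qed
  then show ?thesis using fin ne by blast
qed

section \<open>Unravellings\<close>

definition walk_labels :: "('a, 'r) walk \<Rightarrow> 'r list" where
  "walk_labels s = map fst (snd s)"

definition walk_take :: "nat \<Rightarrow> ('a, 'r) walk \<Rightarrow> ('a, 'r) walk" where
  "walk_take n s = (fst s, take n (snd s))"

lemma length_walk_labels: "length (walk_labels s) = length (snd s)"
  by (simp add: walk_labels_def)

lemma steps_from_append:
  "steps_from \<sigma>r I a (ws @ vs) \<longleftrightarrow>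
     steps_from \<sigma>r I a ws \<and> steps_from \<sigma>r I (walk_last (a, ws)) vs"
  by (induction \<sigma>r I a ws rule: steps_from.induct) auto

lemma steps_from_labels: "steps_from \<sigma>r I a ws \<Longrightarrow> set (map fst ws) \<subseteq> \<sigma>r"
  by (induction \<sigma>r I a ws rule: steps_from.induct) auto

lemma steps_from_dom:
  assumes "interpretation_over \<sigma>c \<sigma>r I"
  shows "steps_from \<sigma>r I a ws \<Longrightarrow> a \<in> dom I \<Longrightarrow> walk_last (a, ws) \<in> dom I"
  using assms
proof (induction ws arbitrary: a)
  case (Cons p ws)
  obtain r b where p: "p = (r, b)" by (cases p)
  then have "b \<in> dom I" using Cons.prems by (auto simp: interpretation_over_def)
  then show ?case using Cons p by (auto split: if_splits)
qed simp

lemma walk_last_snoc [simp]: "walk_last (walk_snoc s r b) = b"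
  by (cases s) simp

lemma snd_walk_snoc [simp]: "snd (walk_snoc s r b) = snd s @ [(r, b)]"
  by (cases s) simp

lemma fst_walk_snoc [simp]: "fst (walk_snoc s r b) = fst s"
  by (cases s) simp

lemma walk_labels_snoc [simp]: "walk_labels (walk_snoc s r b) = walk_labels s @ [r]"
  by (simp add: walk_labels_def)

lemma walk_take_snoc: "n \<le> length (snd s) \<Longrightarrow> walk_take n (walk_snoc s r b) = walk_take n s"
  by (simp add: walk_take_def)

lemma walk_take_all: "length (snd s) \<le> n \<Longrightarrow> walk_take n s = s"
  by (simp add: walk_take_def)

lemma walk_take_take: "walk_take n (walk_take m s) = walk_take (min n m) s"
  by (simp add: walk_take_def)

lemma walk_take_walks: "s \<in> walks \<sigma>r k I d \<Longrightarrow> walk_take n s \<in> walks \<sigma>r k I d"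
  by (auto simp: walks_def walk_take_def)
    (metis append_take_drop_id steps_from_append)

lemma walk_snoc_walks_iff:
  "walk_snoc s r b \<in> walks \<sigma>r k I d \<longleftrightarrow>
     s \<in> walks \<sigma>r k I d \<and> length (snd s) < k \<and> r \<in> \<sigma>r \<and> (walk_last s, b) \<in> rol I r"
  by (cases s) (auto simp: walks_def steps_from_append simp del: walk_last.simps)

text \<open>Puts the edges of an unravelling, which are given by appending a step, into the form
  required by \<open>labelled_tree\<close>.\<close>

lemma walk_labels_snoc_iff:
  "s = walk_take (length (walk_labels s)) t \<and> walk_labels t = walk_labels s @ [r] \<longleftrightarrow>
     (\<exists>b. t = walk_snoc s r b)"
proof
  assume a: "s = walk_take (length (walk_labels s)) t \<and> walk_labels t = walk_labels s @ [r]"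
  obtain u ws where s: "s = (u, ws)" by (cases s)
  obtain u' vs where t: "t = (u', vs)" by (cases t)
  have lab: "map fst vs = map fst ws @ [r]" and ws: "ws = take (length ws) vs" and u: "u = u'"
    using a by (auto simp: s t walk_labels_def walk_take_def)
  then have "vs \<noteq> []" "length vs = Suc (length ws)"
    by (auto dest: arg_cong[of _ _ length])
  then have "vs = ws @ [last vs]"
    using ws by (metis append_butlast_last_id butlast_conv_take diff_Suc_1)
  moreover from this have "fst (last vs) = r"
    using lab by (metis last_map last_snoc \<open>vs \<noteq> []\<close>)
  ultimately show "\<exists>b. t = walk_snoc s r b"
    using s t u by (metis prod.collapse walk_snoc.simps)
next
  assume "\<exists>b. t = walk_snoc s r b"
  then show "s = walk_take (length (walk_labels s)) t \<and> walk_labels t = walk_labels s @ [r]"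
    by (auto simp: walk_take_snoc walk_take_all length_walk_labels)
qed

lemma ordered_unravelling_simps:
  "dom (ordered_unravelling \<sigma>r k I d) = walks \<sigma>r k I d"
  "point (ordered_unravelling \<sigma>r k I d) = (d, [])"
  "conc (ordered_unravelling \<sigma>r k I d) A = {s \<in> walks \<sigma>r k I d. walk_last s \<in> conc I A}"
  "(s, t) \<in> rol (ordered_unravelling \<sigma>r k I d) r \<longleftrightarrow>
     s \<in> walks \<sigma>r k I d \<and> t \<in> walks \<sigma>r k I d \<and> (\<exists>b. t = walk_snoc s r b)"
  "(s, t) \<in> ord (ordered_unravelling \<sigma>r k I d) \<longleftrightarrow>
     s \<in> walks \<sigma>r k I d \<and> t \<in> walks \<sigma>r k I d \<and> fst s = fst t \<and> prefix (snd s) (snd t)"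
  by (auto simp: ordered_unravelling_def unravelling_def Let_def)

lemma labelled_tree_unravelling:
  assumes "pointed_over \<sigma>c \<sigma>r I d"
  shows "labelled_tree \<sigma>c \<sigma>r k (ordered_unravelling \<sigma>r k I d) walk_labels walk_take"
proof -
  have walks: "fst s = d" "length (snd s) \<le> k" "steps_from \<sigma>r I d (snd s)"
    if "s \<in> walks \<sigma>r k I d" for s
    using that by (auto simp: walks_def)
  \<comment> \<open>Being a prefix means being the truncation to one's own length, which is how a
    labelled tree expresses its order.\<close>
  have ord: "(s, t) \<in> ord (ordered_unravelling \<sigma>r k I d) \<longleftrightarrow>
      s \<in> walks \<sigma>r k I d \<and> t \<in> walks \<sigma>r k I d \<and> s = walk_take (length (walk_labels s)) t" for s t
    by (auto simp: ordered_unravelling_simps walk_take_def length_walk_labels prod_eq_iff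
        prefix_def)
      (metis append_take_drop_id)
  show ?thesis
  proof
    fix A assume "A \<notin> \<sigma>c"
    then show "conc (ordered_unravelling \<sigma>r k I d) A = {}"
      using assms by (auto simp: ordered_unravelling_simps pointed_over_def interpretation_over_def)
  next
    fix s t r
    show "(s, t) \<in> rol (ordered_unravelling \<sigma>r k I d) r \<longleftrightarrow>
        (s, t) \<in> ord (ordered_unravelling \<sigma>r k I d) \<and> walk_labels t = walk_labels s @ [r]"
      unfolding ord ordered_unravelling_simps(4) walk_labels_snoc_iff[symmetric] by blast
  next
    fix s assume "s \<in> dom (ordered_unravelling \<sigma>r k I d)"
    then have s: "s \<in> walks \<sigma>r k I d" by (simp add: ordered_unravelling_simps)
    show "set (walk_labels s) \<subseteq> \<sigma>r"
      unfolding walk_labels_def using walks(3)[OF s] by (rule steps_from_labels)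
    show "walk_take 0 s = point (ordered_unravelling \<sigma>r k I d)"
      using walks[OF s] by (simp add: walk_take_def ordered_unravelling_simps)
  qed (auto simp: ordered_unravelling_simps(1-3) ord walk_take_walks walk_take_take walk_take_all
      length_walk_labels walks(2) walk_labels_def take_map,
      auto simp: walks_def walk_take_def take_map)
qed

section \<open>Covers of an unravelling\<close>

text \<open>Isolates properties of a map into walks that suffice for an open pathwise embedding, so
  that one proof serves both projections of the span. The lifting of existential steps enters only
  through \<open>lift_step\<close>.\<close>

locale walk_cover = labelled_tree \<sigma>c \<sigma>r k X lab prune
  for \<sigma>c :: "'c set" and \<sigma>r :: "'r set" and k :: nat
    and X :: "('p, 'c, 'r) ointerp"
    and lab :: "'p \<Rightarrow> 'r list" and prune :: "nat \<Rightarrow> 'p \<Rightarrow> 'p" +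
  fixes I :: "('a, 'c, 'r) interp" and d :: 'a and f :: "'p \<Rightarrow> ('a, 'r) walk"
  assumes pointed: "pointed_over \<sigma>c \<sigma>r I d"
    and f_walks: "x \<in> dom X \<Longrightarrow> f x \<in> walks \<sigma>r k I d"
    and labels_f: "x \<in> dom X \<Longrightarrow> walk_labels (f x) = lab x"
    and f_prune: "x \<in> dom X \<Longrightarrow> f (prune n x) = walk_take n (f x)"
    and conc_iff: "x \<in> conc X A \<longleftrightarrow> x \<in> dom X \<and> walk_last (f x) \<in> conc I A"
    and lift_step: "x \<in> dom X \<Longrightarrow> t \<in> walks \<sigma>r k I d \<Longrightarrow> f x = walk_take (length (lab x)) t \<Longrightarrow>
      length (snd t) = Suc (length (lab x)) \<Longrightarrow> \<exists>y \<in> dom X. f y = t \<and> prune (length (lab x)) y = x"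
begin

abbreviation F :: "(('a, 'r) walk, 'c, 'r) ointerp" where
  "F \<equiv> ordered_unravelling \<sigma>r k I d"

sublocale F: labelled_tree \<sigma>c \<sigma>r k F walk_labels walk_take
  using pointed by (rule labelled_tree_unravelling)

lemma f_dom: "x \<in> dom X \<Longrightarrow> f x \<in> dom F"
  by (simp add: f_walks ordered_unravelling_simps)

lemma f_ord: "(x, y) \<in> ord X \<Longrightarrow> (f x, f y) \<in> ord F"
  by (simp add: ord_iff F.ord_iff f_dom labels_f) (metis f_prune)

lemma f_conc_iff: "x \<in> dom X \<Longrightarrow> f x \<in> conc F A \<longleftrightarrow> x \<in> conc X A"
  by (simp add: conc_iff ordered_unravelling_simps f_walks)

lemma f_rol: "(x, y) \<in> rol X r \<Longrightarrow> (f x, f y) \<in> rol F r"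
  by (auto simp: rol_iff F.rol_iff f_ord labels_f ord_iff)

lemma f_morphism: "morphism f X F"
proof -
  have "f (point X) = point F"
    by (metis F.prune_0 f_dom f_prune point_dom prune_0)
  moreover have "covers (ord F) (f x) (f y)" if "covers (ord X) x y" for x y
    using that f_ord[of x y] by (auto simp: covers_iff F.covers_iff labels_f ord_iff)
  ultimately show ?thesis
    by (auto simp: morphism_def f_dom f_rol f_conc_iff)
qed

text \<open>\<open>lift_step\<close> is iterated over the truncations of \<open>t\<close>, from
  length \<open>level x\<close> up to the full length.\<close>

lemma lift:
  assumes x: "x \<in> dom X" and t: "t \<in> walks \<sigma>r k I d" and fx: "f x = walk_take (level x) t"
  shows "\<exists>y \<in> dom X. f y = t \<and> (x, y) \<in> ord X"
proof -
  have len: "level x \<le> length (snd t)"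
    using fx labels_f[OF x] by (metis length_walk_labels walk_take_def snd_conv length_take min.cobounded1)
  have "n \<le> length (snd t) \<Longrightarrow> \<exists>y \<in> dom X. f y = walk_take n t \<and> (x, y) \<in> ord X"
    if "level x \<le> n" for n
    using that
  proof (induction n rule: dec_induct)
    case base
    then show ?case using x fx ord_refl by blast
  next
    case (step n)
    then obtain y where y: "y \<in> dom X" "f y = walk_take n t" "(x, y) \<in> ord X" by auto
    have ly: "level y = n"
      using y step.prems labels_f[of y] by (metis Suc_leD length_walk_labels length_take min.absorb2 snd_conv walk_take_def)
    obtain z where z: "z \<in> dom X" "f z = walk_take (Suc n) t" "prune (level y) z = y"
      using lift_step[of y "walk_take (Suc n) t"] y step.prems t ly
      by (auto simp: walk_take_walks walk_take_take) (auto simp: walk_take_def)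
    then have "(y, z) \<in> ord X" using y by (simp add: ord_iff)
    then show ?case using z y ord_trans by blast
  qed
  from this[OF len] show ?thesis by (simp add: walk_take_all)
qed

text \<open>The map \<open>f\<close> may merge elements of \<open>X\<close>, but
  \<open>f \<circ> e\<close> is a morphism from a path into the labelled tree \<open>F\<close> and
  therefore injective.\<close>

lemma pathwise: "pathwise_embedding \<sigma>c \<sigma>r k f X F"
  unfolding pathwise_embedding_def path_embedding_def
proof (intro conjI allI impI f_morphism; elim conjE)
  fix P :: "('p, 'c, 'r) ointerp" and e
  assume P: "path \<sigma>c \<sigma>r k P" and e: "embedding e P X"
  then have m: "morphism e P X" by (simp add: embedding_def)
  have e_dom: "e p \<in> dom X" if "p \<in> dom P" for p
    using m that by (auto simp: morphism_def)
  have fm: "morphism (f \<circ> e) P F"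
    using m f_morphism by (auto simp: morphism_def image_subset_iff)
  have "inj_on (f \<circ> e) (dom P)"
    using F.path_morphism_inj[OF P fm] by (auto simp: inj_on_def)
  moreover have "(p, q) \<in> rol P r"
    if dom: "p \<in> dom P" "q \<in> dom P" and r: "(f (e p), f (e q)) \<in> rol F r" for p q r
  proof -
    \<comment> \<open>An edge in \<open>F\<close> is visible in the labels, which \<open>f\<close>
      preserves. The levels are consecutive, so \<open>q\<close> covers \<open>p\<close> in the
      path, and order together with labels yields the edge in \<open>X\<close>.\<close>
    have lab: "lab (e q) = lab (e p) @ [r]"
      using r dom by (simp add: F.rol_iff labels_f e_dom)
    then have "covers (ord P) p q"
      using path_morphism_covers[OF P m dom] by simp
    then have "(e p, e q) \<in> ord X"
      using path_morphism_le[OF P m] by (simp add: covers_def)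
    then have "(e p, e q) \<in> rol X r" using lab by (simp add: rol_iff)
    then show ?thesis using e dom by (auto simp: embedding_def)
  qed
  ultimately show "embedding (f \<circ> e) P F"
    using fm e e_dom by (auto simp: embedding_def f_conc_iff)
qed

lemma opn: "open_morphism \<sigma>c \<sigma>r k f X F"
  unfolding open_morphism_def
proof (intro conjI allI impI f_morphism; elim conjE)
  fix P :: "('p, 'c, 'r) ointerp" and Q :: "(('a, 'r) walk, 'c, 'r) ointerp" and m u v
  assume P: "path \<sigma>c \<sigma>r k P" and Q: "path \<sigma>c \<sigma>r k Q"
    and m: "embedding m P Q" and u: "embedding u P X" and v: "embedding v Q F"
    and comm: "\<forall>p \<in> dom P. f (u p) = v (m p)"
  have um: "morphism u P X" and vm: "morphism v Q F" and mm: "morphism m P Q"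
    using m u v by (auto simp: embedding_def)
  have u_dom: "u p \<in> dom X" "m p \<in> dom Q" if "p \<in> dom P" for p
    using um mm that by (auto simp: morphism_def)
  have v_dom: "v q \<in> dom F" if "q \<in> dom Q" for q
    using vm that by (auto simp: morphism_def)
  obtain p' where p': "p' \<in> dom P" "\<And>p. p \<in> dom P \<Longrightarrow> (p, p') \<in> ord P"
    using path_greatest[OF P] by blast
  obtain q' where q': "q' \<in> dom Q" "\<And>q. q \<in> dom Q \<Longrightarrow> (q, q') \<in> ord Q"
    using path_greatest[OF Q] by blast
  have v_le: "(v q, v q') \<in> ord F" if "q \<in> dom Q" for q
    using F.path_morphism_le[OF Q vm] q' that by simp
  \<comment> \<open>\<open>p'\<close> and \<open>q'\<close> are the tops of the two paths. By
    commutativity \<open>f (u p')\<close> is \<open>v (m p')\<close>, a prefix of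
    \<open>v q'\<close>, so \<open>v q'\<close> lifts to some \<open>y\<close> above
    \<open>u p'\<close>.\<close>
  have "f (u p') = walk_take (level (u p')) (v q')"
    using v_le[OF u_dom(2)[OF p'(1)]] comm p'(1) u_dom(1) labels_f by (metis F.ord_iff)
  then obtain y where y: "y \<in> dom X" "f y = v q'" "(u p', y) \<in> ord X"
    using lift[OF u_dom(1)[OF p'(1)], of "v q'"] v_dom[OF q'(1)]
    by (metis ordered_unravelling_simps(1))
  \<comment> \<open>Once \<open>q'\<close> is sent to \<open>y\<close>, there is no other choice:
    \<open>w q\<close> has to be an ancestor of \<open>y\<close> at the level of
    \<open>v q\<close>.\<close>
  define w where "w q = prune (F.level (v q)) y" for q
  have w_dom: "w q \<in> dom X" for q
    unfolding w_def using y(1) by (rule prune_dom)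
  have f_w: "f (w q) = v q" if "q \<in> dom Q" for q
    unfolding w_def using f_prune[OF y(1)] y(2) v_le[OF that] by (simp add: F.ord_iff)
  have lab_w: "lab (w q) = walk_labels (v q)" if "q \<in> dom Q" for q
    using labels_f[OF w_dom] f_w[OF that] by metis
  have w_ord: "(w q, w r) \<in> ord X" if "q \<in> dom Q" "r \<in> dom Q" "(v q, v r) \<in> ord F" for q r
    using that F.ord_level_le[OF that(3)] w_dom lab_w[OF that(1)]
    by (simp add: ord_iff) (simp add: w_def prune_prune y(1) min.absorb1)
  have w_rol: "(w q, w r) \<in> rol X s \<longleftrightarrow> (q, r) \<in> rol Q s" if "q \<in> dom Q" "r \<in> dom Q" for q r s
  proof
    assume "(w q, w r) \<in> rol X s"
    then have "(v q, v r) \<in> rol F s" using f_rol f_w that by metis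
    then show "(q, r) \<in> rol Q s" using v that by (auto simp: embedding_def)
  next
    assume "(q, r) \<in> rol Q s"
    then have "(v q, v r) \<in> rol F s" using vm that by (auto simp: morphism_def)
    then show "(w q, w r) \<in> rol X s"
      using w_ord that by (simp add: rol_iff F.rol_iff lab_w)
  qed
  have w_covers: "covers (ord X) (w q) (w r)"
    if "q \<in> dom Q" "r \<in> dom Q" "covers (ord Q) q r" for q r
  proof -
    have "covers (ord F) (v q) (v r)" using vm that by (auto simp: morphism_def)
    then show ?thesis using w_ord that by (simp add: covers_iff F.covers_iff lab_w)
  qed
  have w_conc: "w q \<in> conc X A \<longleftrightarrow> q \<in> conc Q A" if "q \<in> dom Q" for q A
    using f_conc_iff[OF w_dom, of q A] f_w[OF that] v that
    unfolding embedding_def morphism_def by metis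
  have "point Q \<in> dom Q"
    using Q by (simp add: path_def is_object_def pointed_over_def)
  moreover have "v (point Q) = point F" using vm by (simp add: morphism_def)
  ultimately have "w (point Q) = point X"
    using y(1) prune_0 by (simp add: w_def F.lab_point)
  moreover have "inj_on w (dom Q)"
  proof (rule inj_onI)
    fix q r assume qr: "q \<in> dom Q" "r \<in> dom Q" "w q = w r"
    then have "v q = v r" using f_w by metis
    then show "q = r" using v qr by (simp add: embedding_def inj_on_def)
  qed
  ultimately have "embedding w Q X"
    by (simp add: embedding_def morphism_def image_subset_iff w_dom w_rol w_covers w_conc)
  \<comment> \<open>Both sides are ancestors of \<open>y\<close> at the same level.\<close>
  moreover have "w (m p) = u p" if p: "p \<in> dom P" for p
  proof -
    have "(u p, y) \<in> ord X"
      using path_morphism_le[OF P um p'(2)[OF p]] y(3) by (rule ord_trans)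
    moreover have "F.level (v (m p)) = level (u p)"
      using comm p u_dom labels_f by metis
    ultimately show ?thesis by (simp add: w_def ord_iff)
  qed
  ultimately show "\<exists>w. embedding w Q X \<and> (\<forall>p\<in>dom P. w (m p) = u p) \<and> (\<forall>q\<in>dom Q. f (w q) = v q)"
    using f_w by blast
qed

end

section \<open>From open pathwise embeddings to concepts\<close>

definition sub_object :: "('p, 'c, 'r) ointerp \<Rightarrow> 'p set \<Rightarrow> ('p, 'c, 'r) ointerp" where
  "sub_object X S =
     \<lparr> dom = S, conc = (\<lambda>A. conc X A \<inter> S), rol = (\<lambda>r. Restr (rol X r) S),
       point = point X, ord = Restr (ord X) S \<rparr>"

lemma sub_object_simps [simp]:
  "dom (sub_object X S) = S"
  "conc (sub_object X S) A = conc X A \<inter> S"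
  "rol (sub_object X S) r = Restr (rol X r) S"
  "point (sub_object X S) = point X"
  "ord (sub_object X S) = Restr (ord X) S"
  by (simp_all add: sub_object_def)

text \<open>Restriction only removes candidates for an intermediate element. The converse can fail
  unless \<open>S\<close> is convex.\<close>

lemma covers_Restr: "covers le x y \<Longrightarrow> x \<in> S \<Longrightarrow> y \<in> S \<Longrightarrow> covers (Restr le S) x y"
  by (auto simp: covers_def)

lemma embedding_into_sub_object:
  "embedding f P X \<Longrightarrow> f ` dom P \<subseteq> S \<Longrightarrow> embedding f P (sub_object X S)"
  by (auto simp: embedding_def morphism_def image_subset_iff intro!: covers_Restr)

text \<open>The elements above the point form a tree order, so the interval up to \<open>x\<close>
  is a finite chain. It is convex, hence its covering pairs are those of \<open>X\<close>; this
  gives both the object conditions and the embedding.\<close>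

lemma
  assumes X: "is_object \<sigma>c \<sigma>r k X" and x: "(point X, x) \<in> ord X"
  defines "P \<equiv> sub_object X {y. (point X, y) \<in> ord X \<and> (y, x) \<in> ord X}"
  shows path_below: "path \<sigma>c \<sigma>r k P"
    and embedding_below: "embedding (\<lambda>y. y) P X"
proof -
  define U where "U = up_set (ord X) (point X)"
  define S where "S = {y. (point X, y) \<in> ord X \<and> (y, x) \<in> ord X}"
  have po: "partial_order_on (dom X) (ord X)"
    and tree: "tree_order_on U (Restr (ord X) U)"
    and height: "height_le k U (Restr (ord X) U)"
    and cov: "\<And>x y. x \<in> U \<Longrightarrow> y \<in> U \<Longrightarrow> covers (ord X) x y \<longleftrightarrow> (\<exists>r \<in> \<sigma>r. (x, y) \<in> rol X r)"
    and interp: "interpretation_over \<sigma>c \<sigma>r X"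
    using X by (auto simp: is_object_def Let_def U_def pointed_over_def)
  have tr: "trans (ord X)" and an: "antisym (ord X)" and sub: "ord X \<subseteq> dom X \<times> dom X"
    and rf: "refl_on (dom X) (ord X)"
    using po by (auto simp: partial_order_on_def preorder_on_def)
  have refl: "(y, y) \<in> ord X" if "(y, z) \<in> ord X \<or> (z, y) \<in> ord X" for y z
    using that sub rf by (auto simp: refl_on_def)
  have SU: "S \<subseteq> U" by (auto simp: S_def U_def up_set_def)
  have SX: "S \<subseteq> dom X" using sub by (auto simp: S_def)
  have pS: "point X \<in> S" and xS: "x \<in> S" using x refl by (auto simp: S_def)
  have "x \<in> U" using xS SU by blast
  have S_eq: "S = {y \<in> U. (y, x) \<in> Restr (ord X) U}"
    using \<open>x \<in> U\<close> by (auto simp: S_def U_def up_set_def)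
  have fin: "finite S" and chain: "S \<in> Chains (Restr (ord X) U)"
    using tree \<open>x \<in> U\<close> unfolding tree_order_on_def S_eq by blast+
  have tot: "(y, z) \<in> ord X \<or> (z, y) \<in> ord X" if "y \<in> S" "z \<in> S" for y z
    using chain that by (auto simp: Chains_def)
  have conv: "z \<in> S" if "y \<in> S" "(y, z) \<in> ord X" "(z, w) \<in> ord X" "w \<in> S" for y z w
    using that transD[OF tr, of "point X" y z] transD[OF tr, of z w x] by (simp add: S_def)
  have cov_iff: "covers (Restr (ord X) S) y z \<longleftrightarrow> covers (ord X) y z" if "y \<in> S" "z \<in> S" for y z
    using that conv unfolding covers_def by blast
  have poS: "partial_order_on S (Restr (ord X) S)"
    unfolding partial_order_on_def preorder_on_def
  proof (intro conjI)
    show "refl_on S (Restr (ord X) S)" using SX rf by (auto simp: refl_on_def)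
    show "trans (Restr (ord X) S)" using tr by (rule trans_Restr)
    show "antisym (Restr (ord X) S)" using an by (rule antisym_subset[rotated]) auto
  qed auto
  have up: "up_set (Restr (ord X) S) (point X) = S"
    using pS by (auto simp: up_set_def S_def)
  have "tree_order_on S (Restr (ord X) S)"
    unfolding tree_order_on_def
  proof (intro conjI ballI)
    show "\<exists>y \<in> S. \<forall>z \<in> S. (y, z) \<in> Restr (ord X) S"
      using pS by (intro bexI[of _ "point X"]) (auto simp: S_def)
  qed (use poS fin tot in \<open>auto simp: Chains_def\<close>)
  moreover have "height_le k S (Restr (ord X) S)"
    unfolding height_le_def
  proof (intro allI impI)
    fix C assume "C \<subseteq> S \<and> C \<in> Chains (Restr (ord X) S)"
    then have "C \<subseteq> U \<and> C \<in> Chains (Restr (ord X) U)"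
      using SU by (auto simp: Chains_def)
    then show "finite C \<and> card C \<le> k + 1"
      using height by (simp add: height_le_def)
  qed
  moreover have "interpretation_over \<sigma>c \<sigma>r (sub_object X S)"
    using interp pS by (auto simp: interpretation_over_def)
  moreover have "covers (Restr (ord X) S) y z \<longleftrightarrow> (\<exists>r \<in> \<sigma>r. (y, z) \<in> Restr (rol X r) S)"
    if "y \<in> S" "z \<in> S" for y z
    using cov_iff[OF that] cov[of y z] that SU by auto
  ultimately have "is_object \<sigma>c \<sigma>r k (sub_object X S)"
    using poS pS by (simp add: is_object_def Let_def up pointed_over_def Int_absorb1)
  then show "path \<sigma>c \<sigma>r k P"
    using poS fin tot
    by (simp add: P_def S_def[symmetric] path_def linear_order_on_def total_on_def)
  show "embedding (\<lambda>y. y) P X"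
    unfolding P_def S_def[symmetric]
    using SX by (auto simp: embedding_def morphism_def cov_iff)
qed

text \<open>The extension is taken in the part of \<open>X\<close> above the point: a role successor in \<open>X\<close> of an
  element above the point need not lie above the point itself, and nothing is known about its
  concepts.\<close>

lemma extension_open_pathwise:
  fixes X :: "('p, 'c, 'r) ointerp" and I :: "('a, 'c, 'r) interp"
  assumes X: "is_object \<sigma>c \<sigma>r k X" and I: "pointed_over \<sigma>c \<sigma>r I d"
    and opn: "open_morphism \<sigma>c \<sigma>r k f X (ordered_unravelling \<sigma>r k I d)"
    and pw: "pathwise_embedding \<sigma>c \<sigma>r k f X (ordered_unravelling \<sigma>r k I d)"
  defines "U \<equiv> up_set (ord X) (point X)"
  shows "C \<in> alc_concepts \<sigma>c \<sigma>r \<Longrightarrow> x \<in> U \<Longrightarrow> length (snd (f x)) + rank C \<le> k \<Longrightarrow>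
    x \<in> extension (sub_object X U) C \<longleftrightarrow> walk_last (f x) \<in> extension I C"
proof -
  define F where "F = ordered_unravelling \<sigma>r k I d"
  interpret F: labelled_tree \<sigma>c \<sigma>r k F walk_labels walk_take
    unfolding F_def using I by (rule labelled_tree_unravelling)
  have interp: "interpretation_over \<sigma>c \<sigma>r I" "d \<in> dom I" using I by (auto simp: pointed_over_def)
  have f_mor: "morphism f X F" using opn by (simp add: open_morphism_def F_def)
  have U: "x \<in> U \<longleftrightarrow> (point X, x) \<in> ord X" for x by (simp add: U_def up_set_def)
  have po: "partial_order_on (dom X) (ord X)"
    using X by (simp add: is_object_def)
  have tr: "trans (ord X)" and sub: "ord X \<subseteq> dom X \<times> dom X" and rf: "refl_on (dom X) (ord X)"
    using po by (auto simp: partial_order_on_def preorder_on_def)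
  have U_dom: "x \<in> dom X" if "x \<in> U" for x using that sub by (auto simp: U)
  have f_walks: "f x \<in> walks \<sigma>r k I d" if "x \<in> U" for x
    using f_mor U_dom[OF that] by (auto simp: morphism_def F_def ordered_unravelling_simps)
  have last_dom: "walk_last (f x) \<in> dom I" if "x \<in> U" for x
    using f_walks[OF that] steps_from_dom[OF interp(1)] interp(2)
    by (auto simp: walks_def simp del: walk_last.simps)
  \<comment> \<open>The test path for \<open>x\<close>. On it \<open>f\<close> is an embedding,
    which turns preservation of concept names at \<open>x\<close> into an equivalence.\<close>
  define P where "P x = sub_object X {y. (point X, y) \<in> ord X \<and> (y, x) \<in> ord X}" for x
  have P: "path \<sigma>c \<sigma>r k (P x)" "embedding (\<lambda>y. y) (P x) X" "x \<in> dom (P x)" if "x \<in> U" for x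
    unfolding P_def using that path_below[OF X] embedding_below[OF X] U_dom[OF that] rf
    by (simp_all add: U refl_on_def)
  have fP: "embedding f (P x) F" if "x \<in> U" for x
  proof -
    have "embedding (f \<circ> (\<lambda>y. y)) (P x) F"
      using pw P[OF that] unfolding pathwise_embedding_def path_embedding_def F_def by blast
    then show ?thesis by (simp add: comp_def)
  qed
  have lifting: "\<exists>w. embedding w Q X \<and> (\<forall>p \<in> dom P. w (m p) = u p) \<and> (\<forall>q \<in> dom Q. f (w q) = v q)"
    if "path \<sigma>c \<sigma>r k P" "path \<sigma>c \<sigma>r k Q" "embedding m P Q" "embedding u P X" "embedding v Q F"
      "\<forall>p \<in> dom P. f (u p) = v (m p)"
    for P :: "('p, 'c, 'r) ointerp" and Q :: "(('a, 'r) walk, 'c, 'r) ointerp" and m u v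
    using opn that unfolding open_morphism_def F_def by blast
  show "x \<in> extension (sub_object X U) C \<longleftrightarrow> walk_last (f x) \<in> extension I C"
    if "C \<in> alc_concepts \<sigma>c \<sigma>r" "x \<in> U" "length (snd (f x)) + rank C \<le> k"
    using that
  proof (induction C arbitrary: x)
    case (Name A)
    have "f x \<in> conc F A \<longleftrightarrow> x \<in> conc (P x) A"
      using fP[OF Name(2)] P(3)[OF Name(2)] by (auto simp: embedding_def morphism_def)
    then show ?case
      using Name(2) f_walks[OF Name(2)] P(3)[OF Name(2)]
      by (simp add: F_def ordered_unravelling_simps P_def)
  next
    case (Neg C)
    then show ?case using last_dom by (simp add: alc_concepts_def)
  next
    case (Conj C D)
    then show ?case by (simp add: alc_concepts_def)
  next
    case (Ex r C)
    have r: "r \<in> \<sigma>r" and C: "C \<in> alc_concepts \<sigma>c \<sigma>r" and k: "length (snd (f x)) < k"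
      using Ex.prems by (auto simp: alc_concepts_def)
    show ?case
    proof
      assume "x \<in> extension (sub_object X U) (Ex r C)"
      then obtain y where y: "(x, y) \<in> rol X r" "y \<in> U" "y \<in> extension (sub_object X U) C"
        by auto
      have "(f x, f y) \<in> rol F r"
        using f_mor y(1,2) Ex.prems(2) U_dom by (auto simp: morphism_def)
      then obtain b where b: "f y = walk_snoc (f x) r b"
        by (auto simp: F_def ordered_unravelling_simps)
      then have "(walk_last (f x), b) \<in> rol I r"
        using f_walks[OF y(2)] by (simp add: walk_snoc_walks_iff)
      \<comment> \<open>The walk \<open>f y\<close> is one step longer and the rank one smaller, so
        the bound of the induction hypothesis still holds.\<close>
      moreover have "b \<in> extension I C"
        using Ex.IH[OF C y(2)] y(3) Ex.prems(3) b by simp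
      ultimately show "walk_last (f x) \<in> extension I (Ex r C)"
        using last_dom[OF Ex.prems(2)] by auto
    next
      assume "walk_last (f x) \<in> extension I (Ex r C)"
      then obtain b where b: "(walk_last (f x), b) \<in> rol I r" "b \<in> extension I C" by auto
      \<comment> \<open>The one-step extension to be lifted; the positive rank of the existential
        leaves room for this step within length \<open>k\<close>.\<close>
      define s where "s = walk_snoc (f x) r b"
      have s: "s \<in> walks \<sigma>r k I d"
        using f_walks[OF Ex.prems(2)] k r b(1) by (simp add: s_def walk_snoc_walks_iff)
      have xs_rol: "(f x, s) \<in> rol F r"
        using s f_walks[OF Ex.prems(2)] by (auto simp: F_def ordered_unravelling_simps s_def)
      then have xs: "(f x, s) \<in> ord F" by (simp add: F.rol_iff)
      \<comment> \<open>The path of prefixes of \<open>s\<close>. Openness is applied to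
        \<open>f\<close> as the map from \<open>P x\<close> to \<open>Q\<close>, with inclusions
        into \<open>X\<close> and \<open>F\<close>, so the square commutes trivially and the lift
        sends \<open>f x\<close> back to \<open>x\<close>.\<close>
      define Q where "Q = sub_object F {t. (point F, t) \<in> ord F \<and> (t, s) \<in> ord F}"
      have sF: "s \<in> dom F" using s by (simp add: F_def ordered_unravelling_simps)
      have Q: "path \<sigma>c \<sigma>r k Q" "embedding (\<lambda>t. t) Q F"
        unfolding Q_def using path_below[OF F.object] embedding_below[OF F.object] F.point_le[OF sF]
        by simp_all
      have fPQ: "embedding f (P x) Q"
        unfolding Q_def
      proof (rule embedding_into_sub_object[OF fP[OF Ex.prems(2)]], rule subsetI)
        fix t assume "t \<in> f ` dom (P x)"
        then obtain y where t: "t = f y" and "y \<in> dom (P x)" by blast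
        then have y: "(y, x) \<in> ord (P x)" "y \<in> dom X"
          using P(3)[OF Ex.prems(2)] sub by (auto simp: P_def)
        then have "(f y, f x) \<in> ord F"
          using F.path_morphism_le[OF P(1)] fP Ex.prems(2) by (simp add: embedding_def)
        then have "(f y, s) \<in> ord F" using xs by (rule F.ord_trans)
        then show "t \<in> {t. (point F, t) \<in> ord F \<and> (t, s) \<in> ord F}"
          by (simp add: t) (metis F.ord_iff F.point_le)
      qed
      have Q_dom: "f x \<in> dom Q" "s \<in> dom Q"
        using xs sF F.ord_refl F.point_le by (auto simp: Q_def F.ord_iff)
      obtain w where w: "embedding w Q X" "w (f x) = x" "f (w s) = s"
        using lifting[OF P(1)[OF Ex.prems(2)] Q(1) fPQ P(2)[OF Ex.prems(2)] Q(2)]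
          P(3)[OF Ex.prems(2)] Q_dom by auto
      have w_rol: "(w t, w u) \<in> rol X p" if "t \<in> dom Q" "u \<in> dom Q" "(t, u) \<in> rol Q p" for t u p
        using w(1) that unfolding embedding_def morphism_def by blast
      have w_covers: "covers (ord X) (w t) (w u)"
        if "t \<in> dom Q" "u \<in> dom Q" "covers (ord Q) t u" for t u
        using w(1) that unfolding embedding_def morphism_def by blast
      have "(f x, s) \<in> rol Q r" using xs_rol Q_dom by (simp add: Q_def)
      then have rol: "(x, w s) \<in> rol X r"
        using w_rol[OF Q_dom] w(2) by metis
      \<comment> \<open>The edge is also a covering pair, which \<open>w\<close> preserves; so
        \<open>w s\<close> lies above \<open>x\<close> and hence above the point, where the
        induction hypothesis applies.\<close>
      have "covers (ord F) (f x) s" using xs_rol r F.covers_iff_rol by blast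
      then have "covers (ord Q) (f x) s"
        using Q_dom unfolding Q_def sub_object_simps by (rule covers_Restr)
      then have "covers (ord X) x (w s)"
        using w_covers[OF Q_dom] w(2) by metis
      then have wU: "w s \<in> U"
        using Ex.prems(2) transD[OF tr, of "point X" x "w s"] by (simp add: U covers_def)
      moreover have "w s \<in> extension (sub_object X U) C"
        using Ex.IH[OF C wU] w(3) b(2) Ex.prems(3) by (simp add: s_def)
      ultimately show "x \<in> extension (sub_object X U) (Ex r C)"
        using rol Ex.prems(2) by auto
    qed
  qed
qed

text \<open>The point is sent to walks of length 0, so the whole rank \<open>k\<close> is available.
  Both interpretations are compared with the same part of \<open>X\<close> above its point.\<close>

lemma open_span_imp_alc_equiv:
  fixes I :: "('a, 'c, 'r) interp" and J :: "('b, 'c, 'r) interp"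
  assumes I: "pointed_over \<sigma>c \<sigma>r I d" and J: "pointed_over \<sigma>c \<sigma>r J e"
    and span: "open_span TYPE('p) \<sigma>c \<sigma>r k I d J e"
  shows "alc_equiv \<sigma>c \<sigma>r k I d J e"
proof -
  obtain X :: "('p, 'c, 'r) ointerp" and f g where X: "is_object \<sigma>c \<sigma>r k X"
    and f: "open_morphism \<sigma>c \<sigma>r k f X (ordered_unravelling \<sigma>r k I d)"
      "pathwise_embedding \<sigma>c \<sigma>r k f X (ordered_unravelling \<sigma>r k I d)"
    and g: "open_morphism \<sigma>c \<sigma>r k g X (ordered_unravelling \<sigma>r k J e)"
      "pathwise_embedding \<sigma>c \<sigma>r k g X (ordered_unravelling \<sigma>r k J e)"
    using span unfolding open_span_def by blast
  have "point X \<in> up_set (ord X) (point X)"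
    using X by (auto simp: is_object_def pointed_over_def up_set_def partial_order_on_def
        preorder_on_def refl_on_def)
  moreover have "f (point X) = (d, [])" "g (point X) = (e, [])"
    using f g by (auto simp: open_morphism_def morphism_def ordered_unravelling_simps)
  ultimately show ?thesis
    unfolding alc_equiv_def
    using extension_open_pathwise[OF X I f, of _ "point X"]
      extension_open_pathwise[OF X J g, of _ "point X"] by simp
qed

section \<open>The span of a graded bisimulation\<close>

lemma walk_eq_snoc:
  assumes "length (snd t) = Suc n"
  shows "\<exists>r b. t = walk_snoc (walk_take n t) r b"
proof -
  have "snd t = take n (snd t) @ [last (snd t)]"
    using assms by (metis append_butlast_last_id butlast_conv_take diff_Suc_1 length_0_conv nat.distinct(1))
  then have "t = walk_snoc (walk_take n t) (fst (last (snd t))) (snd (last (snd t)))"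
    by (simp add: walk_take_def prod_eq_iff)
  then show ?thesis by blast
qed

text \<open>The index of \<open>Z\<close> counts the steps still to be matched.\<close>

locale graded_bisimulation =
  fixes \<sigma>c :: "'c set" and \<sigma>r :: "'r set" and k :: nat
    and I :: "('a, 'c, 'r) interp" and d :: 'a
    and J :: "('b, 'c, 'r) interp" and e :: 'b
    and Z :: "nat \<Rightarrow> 'a \<Rightarrow> 'b \<Rightarrow> bool"
  assumes I: "pointed_over \<sigma>c \<sigma>r I d" and J: "pointed_over \<sigma>c \<sigma>r J e"
    and base: "Z k d e"
    and atoms: "Z n a b \<Longrightarrow> a \<in> conc I A \<longleftrightarrow> b \<in> conc J A"
    and zig: "Z (Suc n) a b \<Longrightarrow> r \<in> \<sigma>r \<Longrightarrow> (a, a') \<in> rol I r \<Longrightarrow> \<exists>b'. (b, b') \<in> rol J r \<and> Z n a' b'"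
    and zag: "Z (Suc n) a b \<Longrightarrow> r \<in> \<sigma>r \<Longrightarrow> (b, b') \<in> rol J r \<Longrightarrow> \<exists>a'. (a, a') \<in> rol I r \<and> Z n a' b'"
begin

text \<open>After \<open>i\<close> steps \<open>k - i\<close> remain. Asking for \<open>Z\<close> at
  every position, not only at the last, makes the set closed under truncation, so that it forms a
  tree.\<close>

definition pairs :: "(('a, 'r) walk \<times> ('b, 'r) walk) set" where
  "pairs = {(s, t). s \<in> walks \<sigma>r k I d \<and> t \<in> walks \<sigma>r k J e \<and> walk_labels s = walk_labels t \<and>
     (\<forall>i \<le> length (snd s). Z (k - i) (walk_last (walk_take i s)) (walk_last (walk_take i t)))}"

definition pair_take ::
  "nat \<Rightarrow> ('a, 'r) walk \<times> ('b, 'r) walk \<Rightarrow> ('a, 'r) walk \<times> ('b, 'r) walk" where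
  "pair_take n x = (walk_take n (fst x), walk_take n (snd x))"

definition pair_labels :: "('a, 'r) walk \<times> ('b, 'r) walk \<Rightarrow> 'r list" where
  "pair_labels x = walk_labels (fst x)"

definition pair_ord :: "(('a, 'r) walk \<times> ('b, 'r) walk) rel" where
  "pair_ord = {(x, y). x \<in> pairs \<and> y \<in> pairs \<and> x = pair_take (length (pair_labels x)) y}"

definition pair_tree :: "(('a, 'r) walk \<times> ('b, 'r) walk, 'c, 'r) ointerp" where
  "pair_tree =
     \<lparr> dom = pairs,
       conc = (\<lambda>A. {x \<in> pairs. walk_last (fst x) \<in> conc I A}),
       rol = (\<lambda>r. {(x, y) \<in> pair_ord. pair_labels y = pair_labels x @ [r]}),
       point = ((d, []), (e, [])),
       ord = pair_ord \<rparr>"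

lemma pairs_Z:
  "x \<in> pairs \<Longrightarrow> i \<le> length (snd (fst x)) \<Longrightarrow>
    Z (k - i) (walk_last (walk_take i (fst x))) (walk_last (walk_take i (snd x)))"
  by (auto simp: pairs_def)

lemma pairsD:
  assumes "x \<in> pairs"
  shows "fst x \<in> walks \<sigma>r k I d" "snd x \<in> walks \<sigma>r k J e"
    "walk_labels (fst x) = pair_labels x" "walk_labels (snd x) = pair_labels x"
    "length (snd (fst x)) = length (pair_labels x)" "length (snd (snd x)) = length (pair_labels x)"
    "Z (k - length (pair_labels x)) (walk_last (fst x)) (walk_last (snd x))"
proof -
  show *: "fst x \<in> walks \<sigma>r k I d" "snd x \<in> walks \<sigma>r k J e"
    "walk_labels (fst x) = pair_labels x" "walk_labels (snd x) = pair_labels x"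
    using assms by (auto simp: pairs_def pair_labels_def)
  then show len: "length (snd (fst x)) = length (pair_labels x)"
    "length (snd (snd x)) = length (pair_labels x)"
    by (metis length_walk_labels)+
  show "Z (k - length (pair_labels x)) (walk_last (fst x)) (walk_last (snd x))"
    using pairs_Z[OF assms, of "length (pair_labels x)"] by (simp add: len walk_take_all)
qed

lemma pair_take_pairs:
  assumes "x \<in> pairs"
  shows "pair_take n x \<in> pairs"
proof -
  have "walk_labels (walk_take n (fst x)) = walk_labels (walk_take n (snd x))"
    using pairsD[OF assms] by (simp add: walk_labels_def walk_take_def take_map[symmetric])
  moreover have "Z (k - i) (walk_last (walk_take i (walk_take n (fst x))))
      (walk_last (walk_take i (walk_take n (snd x))))"
    if "i \<le> length (snd (walk_take n (fst x)))" for i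
  proof -
    have i: "i \<le> length (snd (fst x))" "min i n = i" using that by (auto simp: walk_take_def)
    show ?thesis using pairs_Z[OF assms i(1)] by (simp only: walk_take_take i(2))
  qed
  ultimately show ?thesis
    using pairsD[OF assms] by (auto simp: pairs_def pair_take_def walk_take_walks)
qed

lemma snoc_pairs:
  assumes x: "(s, t) \<in> pairs" and s: "walk_snoc s r a \<in> walks \<sigma>r k I d"
    and t: "walk_snoc t r b \<in> walks \<sigma>r k J e" and Z: "Z (k - Suc (length (snd s))) a b"
  shows "(walk_snoc s r a, walk_snoc t r b) \<in> pairs"
proof -
  have len: "length (snd t) = length (snd s)" using pairsD[OF x] by simp
  have "Z (k - i) (walk_last (walk_take i (walk_snoc s r a)))
      (walk_last (walk_take i (walk_snoc t r b)))"
    if i: "i \<le> Suc (length (snd s))" for i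
  proof (cases "i = Suc (length (snd s))")
    case True
    then show ?thesis using Z len by (simp add: walk_take_all)
  next
    case False
    then have "i \<le> length (snd s)" using i by simp
    then show ?thesis using x len by (simp add: pairs_def walk_take_snoc)
  qed
  then show ?thesis
    using x s t by (auto simp: pairs_def)
qed

section \<open>The tree of related walks and its two projections\<close>

lemma labelled_tree_pair_tree: "labelled_tree \<sigma>c \<sigma>r k pair_tree pair_labels pair_take"
proof
  fix A assume "A \<notin> \<sigma>c"
  then show "conc pair_tree A = {}"
    using I by (simp add: pair_tree_def pointed_over_def interpretation_over_def)
next
  show "point pair_tree \<in> dom pair_tree"
    using base by (simp add: pair_tree_def pairs_def walks_def walk_labels_def walk_take_def)
next
  fix x assume "x \<in> dom pair_tree"
  then have x: "x \<in> pairs" by (simp add: pair_tree_def)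
  note D = pairsD[OF x]
  show "set (pair_labels x) \<subseteq> \<sigma>r"
    using D(1) steps_from_labels by (fastforce simp: pair_labels_def walk_labels_def walks_def)
  show "length (pair_labels x) \<le> k"
    using D(1) D(5) by (auto simp: walks_def)
  show "pair_take 0 x = point pair_tree"
    using D(1,2) by (auto simp: pair_take_def walk_take_def pair_tree_def walks_def)
  show "pair_take (length (pair_labels x)) x = x"
    using D by (simp add: pair_take_def walk_take_all)
qed (auto simp: pair_tree_def pair_take_pairs pair_ord_def,
    auto simp: pair_labels_def pair_take_def walk_labels_def walk_take_def take_map)

lemma walk_cover_fst: "walk_cover \<sigma>c \<sigma>r k pair_tree pair_labels pair_take I d fst"
proof (intro walk_cover.intro labelled_tree_pair_tree walk_cover_axioms.intro I)
  fix x t assume "x \<in> dom pair_tree" and t: "t \<in> walks \<sigma>r k I d"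
    and fx: "fst x = walk_take (length (pair_labels x)) t"
    and len: "length (snd t) = Suc (length (pair_labels x))"
  then have x: "x \<in> pairs" by (simp add: pair_tree_def)
  note D = pairsD[OF x]
  obtain r a where t_eq: "t = walk_snoc (fst x) r a" using walk_eq_snoc[OF len] fx by metis
  then have ra: "length (pair_labels x) < k" "r \<in> \<sigma>r" "(walk_last (fst x), a) \<in> rol I r"
    using t D(5) by (simp_all add: walk_snoc_walks_iff)
  \<comment> \<open>The walk is shorter than \<open>k\<close>, so the remaining number of steps is a
    successor, as \<open>zig\<close> requires.\<close>
  then have "Z (Suc (k - Suc (length (pair_labels x)))) (walk_last (fst x)) (walk_last (snd x))"
    using D(7) by (simp add: Suc_diff_Suc)
  then obtain b where b: "(walk_last (snd x), b) \<in> rol J r" "Z (k - Suc (length (pair_labels x))) a b"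
    using zig ra(2,3) by blast
  then have "(t, walk_snoc (snd x) r b) \<in> pairs"
    unfolding t_eq using x t t_eq D ra by (intro snoc_pairs) (simp_all add: walk_snoc_walks_iff)
  moreover have "pair_take (length (pair_labels x)) (t, walk_snoc (snd x) r b) = x"
    using D(5,6) by (simp add: pair_take_def t_eq walk_take_snoc walk_take_all)
  ultimately show "\<exists>y \<in> dom pair_tree. fst y = t \<and> pair_take (length (pair_labels x)) y = x"
    by (intro bexI[of _ "(t, walk_snoc (snd x) r b)"]) (simp_all add: pair_tree_def)
qed (auto simp: pair_tree_def pair_take_def pairsD(1,3))

lemma walk_cover_snd: "walk_cover \<sigma>c \<sigma>r k pair_tree pair_labels pair_take J e snd"
proof (intro walk_cover.intro labelled_tree_pair_tree walk_cover_axioms.intro J)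
  fix x t assume "x \<in> dom pair_tree" and t: "t \<in> walks \<sigma>r k J e"
    and fx: "snd x = walk_take (length (pair_labels x)) t"
    and len: "length (snd t) = Suc (length (pair_labels x))"
  then have x: "x \<in> pairs" by (simp add: pair_tree_def)
  note D = pairsD[OF x]
  obtain r b where t_eq: "t = walk_snoc (snd x) r b" using walk_eq_snoc[OF len] fx by metis
  then have rb: "length (pair_labels x) < k" "r \<in> \<sigma>r" "(walk_last (snd x), b) \<in> rol J r"
    using t D(6) by (simp_all add: walk_snoc_walks_iff)
  then have "Z (Suc (k - Suc (length (pair_labels x)))) (walk_last (fst x)) (walk_last (snd x))"
    using D(7) by (simp add: Suc_diff_Suc)
  then obtain a where a: "(walk_last (fst x), a) \<in> rol I r" "Z (k - Suc (length (pair_labels x))) a b"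
    using zag rb(2,3) by blast
  then have "(walk_snoc (fst x) r a, t) \<in> pairs"
    unfolding t_eq using x t t_eq D rb by (intro snoc_pairs) (simp_all add: walk_snoc_walks_iff)
  moreover have "pair_take (length (pair_labels x)) (walk_snoc (fst x) r a, t) = x"
    using D(5,6) by (simp add: pair_take_def t_eq walk_take_snoc walk_take_all)
  ultimately show "\<exists>y \<in> dom pair_tree. snd y = t \<and> pair_take (length (pair_labels x)) y = x"
    by (intro bexI[of _ "(walk_snoc (fst x) r a, t)"]) (simp_all add: pair_tree_def)
next
  fix x A
  \<comment> \<open>Concept names of \<open>pair_tree\<close> are read off the first component;
    \<open>atoms\<close> at the last position carries them to the second.\<close>
  show "x \<in> conc pair_tree A \<longleftrightarrow> x \<in> dom pair_tree \<and> walk_last (snd x) \<in> conc J A"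
    by (auto simp: pair_tree_def atoms[OF pairsD(7)] simp del: walk_last.simps)
qed (auto simp: pair_tree_def pair_take_def pairsD(2,4))

lemma span: "open_span TYPE(('a, 'r) walk \<times> ('b, 'r) walk) \<sigma>c \<sigma>r k I d J e"
  unfolding open_span_def
  using labelled_tree.object[OF labelled_tree_pair_tree]
    walk_cover.opn[OF walk_cover_fst] walk_cover.pathwise[OF walk_cover_fst]
    walk_cover.opn[OF walk_cover_snd] walk_cover.pathwise[OF walk_cover_snd]
  by blast

end

section \<open>Finitely many test concepts\<close>

text \<open>One conjunction per choice of signs for the members of \<open>L\<close>. The concept
  \<open>T\<close> closes each of them, since the grammar has no empty conjunction.\<close>

primrec sign_conjs :: "('c, 'r) alc \<Rightarrow> ('c, 'r) alc list \<Rightarrow> ('c, 'r) alc list" where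
  "sign_conjs T [] = [T]"
| "sign_conjs T (C # L) = map (Conj C) (sign_conjs T L) @ map (Conj (Neg C)) (sign_conjs T L)"

text \<open>The element \<open>x\<close> dictates the signs: each member of \<open>L\<close> or else
  its negation holds there.\<close>

lemma sign_conjs_cover:
  "x \<in> dom I \<Longrightarrow> x \<in> extension I T \<Longrightarrow> \<exists>D \<in> set (sign_conjs T L). x \<in> extension I D"
proof (induction L)
  case (Cons C L)
  then obtain D where D: "D \<in> set (sign_conjs T L)" "x \<in> extension I D" by blast
  show ?case
  proof (cases "x \<in> extension I C")
    case True
    then show ?thesis using D by (intro bexI[of _ "Conj C D"]) auto
  next
    case False
    then show ?thesis using D Cons.prems by (intro bexI[of _ "Conj (Neg C) D"]) auto
  qed
qed simp

text \<open>A signed conjunction fixes the truth value of every member of \<open>L\<close>, even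
  across two interpretations.\<close>

lemma sign_conjs_decide:
  "D \<in> set (sign_conjs T L) \<Longrightarrow> x \<in> extension I D \<Longrightarrow> y \<in> extension J D \<Longrightarrow>
    \<forall>C \<in> set L. x \<in> extension I C \<longleftrightarrow> y \<in> extension J C"
  by (induction L arbitrary: D) auto

lemma alc_concepts_iff [simp]:
  "Name A \<in> alc_concepts \<sigma>c \<sigma>r \<longleftrightarrow> A \<in> \<sigma>c"
  "Neg C \<in> alc_concepts \<sigma>c \<sigma>r \<longleftrightarrow> C \<in> alc_concepts \<sigma>c \<sigma>r"
  "Conj C D \<in> alc_concepts \<sigma>c \<sigma>r \<longleftrightarrow> C \<in> alc_concepts \<sigma>c \<sigma>r \<and> D \<in> alc_concepts \<sigma>c \<sigma>r"
  "Ex r C \<in> alc_concepts \<sigma>c \<sigma>r \<longleftrightarrow> r \<in> \<sigma>r \<and> C \<in> alc_concepts \<sigma>c \<sigma>r"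
  by (auto simp: alc_concepts_def)

lemma sign_conjs_alc_concepts:
  "T \<in> alc_concepts \<sigma>c \<sigma>r \<Longrightarrow> set L \<subseteq> alc_concepts \<sigma>c \<sigma>r \<Longrightarrow>
    set (sign_conjs T L) \<subseteq> alc_concepts \<sigma>c \<sigma>r"
  by (induction L) auto

lemma sign_conjs_rank:
  "rank T \<le> n \<Longrightarrow> \<forall>C \<in> set L. rank C \<le> n \<Longrightarrow> \<forall>D \<in> set (sign_conjs T L). rank D \<le> n"
  by (induction L) auto

definition top_concept :: "'c \<Rightarrow> ('c, 'r) alc" where
  "top_concept A = Neg (Conj (Name A) (Neg (Name A)))"

text \<open>If \<open>cs\<close> is empty, \<open>hd cs\<close> is a junk name outside the signature; this is where a nonempty
  \<open>\<sigma>c\<close> is needed.\<close>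

primrec test_concepts :: "'c list \<Rightarrow> 'r list \<Rightarrow> nat \<Rightarrow> ('c, 'r) alc list" where
  "test_concepts cs rs 0 = map Name cs"
| "test_concepts cs rs (Suc n) = map Name cs @
     [Ex r D. r \<leftarrow> rs, D \<leftarrow> sign_conjs (top_concept (hd cs)) (test_concepts cs rs n)]"

text \<open>The junk name can enter only through an existential, and none arises for an empty role
  list or at rank 0.\<close>

lemma test_concepts_alc_concepts:
  assumes "cs \<noteq> [] \<or> rs = [] \<or> n = 0"
  shows "set (test_concepts cs rs n) \<subseteq> alc_concepts (set cs) (set rs)"
  using assms
proof (induction n)
  case (Suc n)
  show ?case
  proof (cases "rs = []")
    case False
    then have cs: "cs \<noteq> []" using Suc.prems by simp
    then have "top_concept (hd cs) \<in> alc_concepts (set cs) (set rs)"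
      by (simp add: top_concept_def)
    from sign_conjs_alc_concepts[OF this, of "test_concepts cs rs n"] Suc.IH cs
    show ?thesis by auto
  qed auto
qed auto

lemma test_concepts_rank: "\<forall>C \<in> set (test_concepts cs rs n). rank C \<le> n"
proof (induction n)
  case (Suc n)
  have "rank (top_concept (hd cs)) \<le> n" by (simp add: top_concept_def)
  from sign_conjs_rank[OF this Suc.IH] show ?case by auto
qed auto

section \<open>Agreement on test concepts as a graded bisimulation\<close>

definition test_equiv ::
  "'c list \<Rightarrow> 'r list \<Rightarrow> nat \<Rightarrow> ('a, 'c, 'r) interp \<Rightarrow> 'a \<Rightarrow> ('b, 'c, 'r) interp \<Rightarrow> 'b \<Rightarrow> bool" where
  "test_equiv cs rs n I a J b \<longleftrightarrow>
     (\<forall>C \<in> set (test_concepts cs rs n). a \<in> extension I C \<longleftrightarrow> b \<in> extension J C)"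

lemma test_equiv_sym: "test_equiv cs rs n I a J b \<longleftrightarrow> test_equiv cs rs n J b I a"
  unfolding test_equiv_def by blast

lemma test_equiv_atoms:
  assumes "test_equiv cs rs n I a J b" "A \<in> set cs"
  shows "a \<in> conc I A \<longleftrightarrow> b \<in> conc J A"
proof -
  have "Name A \<in> set (test_concepts cs rs n)" using assms(2) by (cases n) auto
  then have "a \<in> extension I (Name A) \<longleftrightarrow> b \<in> extension J (Name A)"
    using assms(1) unfolding test_equiv_def by blast
  then show ?thesis by simp
qed

text \<open>Let \<open>D\<close> be a sign conjunction that holds at \<open>a'\<close>. Then
  \<open>Ex r D\<close> is a test concept for \<open>Suc n\<close>, so it moves from
  \<open>a\<close> to \<open>b\<close>, and any witness at \<open>b\<close> satisfies
  \<open>D\<close>, hence agrees with \<open>a'\<close> on the test concepts for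
  \<open>n\<close>.\<close>

lemma test_equiv_forth:
  assumes I: "interpretation_over \<sigma>c \<sigma>r I" and Z: "test_equiv cs rs (Suc n) I a J b"
    and r: "r \<in> set rs" and a': "(a, a') \<in> rol I r"
  shows "\<exists>b'. (b, b') \<in> rol J r \<and> test_equiv cs rs n I a' J b'"
proof -
  have dom: "a \<in> dom I" "a' \<in> dom I" using I a' by (auto simp: interpretation_over_def)
  then have "a' \<in> extension I (top_concept (hd cs))" by (simp add: top_concept_def)
  then obtain D where
    D: "D \<in> set (sign_conjs (top_concept (hd cs)) (test_concepts cs rs n))" "a' \<in> extension I D"
    using sign_conjs_cover[OF dom(2)] by blast
  have "a \<in> extension I (Ex r D)" using dom(1) a' D(2) by auto
  moreover have "Ex r D \<in> set (test_concepts cs rs (Suc n))" using D(1) r by auto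
  ultimately have "b \<in> extension J (Ex r D)" using Z unfolding test_equiv_def by blast
  then obtain b' where b': "(b, b') \<in> rol J r" "b' \<in> extension J D" by auto
  have "test_equiv cs rs n I a' J b'"
    unfolding test_equiv_def by (rule sign_conjs_decide[OF D b'(2)])
  then show ?thesis using b'(1) by blast
qed

lemma alc_equiv_imp_open_span:
  fixes I :: "('a, 'c, 'r) interp" and J :: "('b, 'c, 'r) interp"
  assumes fin: "finite \<sigma>c" "finite \<sigma>r"
    and I: "pointed_over \<sigma>c \<sigma>r I d" and J: "pointed_over \<sigma>c \<sigma>r J e"
    and nontriv: "\<sigma>c = {} \<longrightarrow> \<sigma>r = {} \<or> k = 0"
    and eq: "alc_equiv \<sigma>c \<sigma>r k I d J e"
  shows "open_span TYPE(('a, 'r) walk \<times> ('b, 'r) walk) \<sigma>c \<sigma>r k I d J e"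
proof -
  obtain cs rs where cs: "set cs = \<sigma>c" and rs: "set rs = \<sigma>r"
    using fin finite_list by metis
  have int: "interpretation_over \<sigma>c \<sigma>r I" "interpretation_over \<sigma>c \<sigma>r J"
    using I J by (auto simp: pointed_over_def)
  \<comment> \<open>This keeps the test concepts for \<open>k\<close> inside the signature, so that
    the assumed equivalence applies to them.\<close>
  have "cs \<noteq> [] \<or> rs = [] \<or> k = 0" using nontriv cs rs by auto
  then have "test_equiv cs rs k I d J e"
    using eq test_concepts_alc_concepts[of cs rs k] test_concepts_rank[of cs rs k]
    by (auto simp: test_equiv_def alc_equiv_def cs rs)
  then interpret graded_bisimulation \<sigma>c \<sigma>r k I d J e "\<lambda>n a b. test_equiv cs rs n I a J b"
  proof (intro graded_bisimulation.intro I J)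
    fix n a b A assume "test_equiv cs rs n I a J b"
    \<comment> \<open>Names outside the signature are empty in both interpretations.\<close>
    then show "a \<in> conc I A \<longleftrightarrow> b \<in> conc J A"
      using test_equiv_atoms[of cs rs n I a J b A] int cs
      by (cases "A \<in> \<sigma>c") (auto simp: interpretation_over_def)
  next
    fix n a b r a' assume "test_equiv cs rs (Suc n) I a J b" "r \<in> \<sigma>r" "(a, a') \<in> rol I r"
    then show "\<exists>b'. (b, b') \<in> rol J r \<and> test_equiv cs rs n I a' J b'"
      by (intro test_equiv_forth[OF int(1)]) (simp_all add: rs)
  next
    fix n a b r b' assume "test_equiv cs rs (Suc n) I a J b" "r \<in> \<sigma>r" "(b, b') \<in> rol J r"
    \<comment> \<open>The back condition is the forth condition with the interpretations
      exchanged.\<close>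
    then have "\<exists>a'. (a, a') \<in> rol I r \<and> test_equiv cs rs n J b' I a'"
      by (intro test_equiv_forth[OF int(2)]) (simp_all add: rs test_equiv_sym[of _ _ _ J])
    then show "\<exists>a'. (a, a') \<in> rol I r \<and> test_equiv cs rs n I a' J b'"
      by (simp add: test_equiv_sym[of _ _ _ J])
  qed
  show ?thesis by (rule span)
qed

(* The last assumption is needed because the grammar has no top concept: if \<sigma>c is empty, there are no
   concepts at all and rank-k equivalence is vacuous, while k-bisimilarity is not as soon as
   k > 0 and \<sigma>r is nonempty.

   The first conjunct is the equivalence, with R carried by pairs of sequences. The second one, in which
   the type 'p is arbitrary, says that choosing another carrier type for R does not relate more
   interpretations; so "there exists an object R" does not depend on the carrier. *)
theorem theorem4:
  fixes \<sigma>c :: "'c set" and \<sigma>r :: "'r set" and k :: nat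
    and I :: "('a, 'c, 'r) interp" and d :: 'a
    and J :: "('b, 'c, 'r) interp" and e :: 'b
  assumes "finite \<sigma>c" and "finite \<sigma>r"
    and "pointed_over \<sigma>c \<sigma>r I d" and "pointed_over \<sigma>c \<sigma>r J e"
    and "\<sigma>c = {} \<longrightarrow> \<sigma>r = {} \<or> k = 0"
  shows "(alc_equiv \<sigma>c \<sigma>r k I d J e \<longleftrightarrow>
            open_span TYPE(('a, 'r) walk \<times> ('b, 'r) walk) \<sigma>c \<sigma>r k I d J e) \<and>
         (open_span TYPE('p) \<sigma>c \<sigma>r k I d J e \<longrightarrow> alc_equiv \<sigma>c \<sigma>r k I d J e)"
  using alc_equiv_imp_open_span[OF assms(1-5)]
    open_span_imp_alc_equiv[OF assms(3,4), where 'p = "('a, 'r) walk \<times> ('b, 'r) walk"]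
    open_span_imp_alc_equiv[OF assms(3,4), where 'p = 'p]
  by blast

end
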